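(* For each $\eta\in\mathbb{G}_m$, the staircase cross-ratio dynamics has a scaling symmetry $\rho^{(\eta)}$ that acts in the following way on the cross-ratio coordinates $c_i$ and the discrete curvature $\mu_i$: $$\mu_i^{(\eta)}(t)=\frac{t\mu_i}{1+(t-1)\eta\mu_i},\qquad c_i^{(\eta)}(t)=c_i\,\frac{t\mu_i}{\mu_i^{(\eta)}(t)}.$$ It is well defined for $t\neq1-(\eta\mu_i)^{-1}$ (for all $i$).
   Context: Let $F$ be a field, $\mathbb{P}^1=\mathbb{P}^1(F)$, $\mathrm{PGL}_2=\mathrm{GL}_2(F)/F^*$, $\mathbb{G}_m=F^*$ (as algebraic group), $n\geq3$. For four points of $\mathbb{P}^1$, $[a,b,c,d]=\frac{a-c}{a-d}\cdot\frac{b-d}{b-c}$. A (twisted) $n$-gon in $\mathbb{P}^1$ is $P=((p_i)_{i\in\mathbb{Z}},M)$ with monodromy $M\in\mathrm{PGL}_2$, $p_{i+n}=Mp_i$, with $p_i,p_{i+1},p_{i+2}$ pairwise distinct for all $i$. $\mathrm{PGL}_2$ acts by $A\cdot P=((Ap_i),AMA^{-1})$, with quotient the moduli space $\mathcal T_n$. The cross-ratio coordinates $c_i=[p_i,p_{i+1},p_{i-1},p_{i+2}]$ ($n$-periodic) determine the class $[P]$. Polygons are enriched with an $n$-periodic discrete curvature $\mu=(\mu_i)$, $\mu_i\in\mathbb{G}_m$, unchanged by $\mathrm{PGL}_2$. For $\alpha,\beta\in\mathbb{G}_m$ and distinct $b,d\in\mathbb{P}^1$, $h^{\alpha/\beta}_{b,d}$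 is the projective transformation sending $a$ to the point $c$ with $[a,c,b,d]=\alpha/\beta$. For $j\in\mathbb{Z}/n\mathbb{Z}$, the flip at index $j$ is $\phi_j:(P,\mu)\mapsto(\tilde P,\tilde\mu)$, where $\tilde P$ has the same monodromy as $P$ and: $\tilde p_i=h^{\mu_i/\mu_{i-1}}_{p_{i+1},p_{i-1}}(p_i)$ for $i\in n\mathbb{Z}+j$; $\tilde p_i=p_i$ for $i\notin n\mathbb{Z}+j$; $\tilde\mu_{i-1}=\mu_i$ and $\tilde\mu_i=\mu_{i-1}$ for $i\in n\mathbb{Z}+j$; the other $\mu_i$ are unchanged. The staircase cross-ratio dynamics is the action of the group $\Gamma_n=\langle\phi_1,\dots,\phi_n\rangle$. A scaling symmetry is a non-trivial action of the algebraic group $\mathbb{G}_m$ (possibly undefined for some values of $t$) on the moduli space, here on pairs $([P],\mu)$ in the coordinates $(c,\mu)$, which commutes with the dynamic, i.e. with the action of every flip $\phi_j$ on the moduli space. *)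

theory Defs
  imports
    "HOL-Analysis.Determinants"
    "HOL-Computational_Algebra.Polynomial_Factorial"
begin

section \<open>The projective line and its group of projective transformations\<close>

definition proportional :: "'a::field^2 \<Rightarrow> 'a^2 \<Rightarrow> bool" where
  "proportional v w \<longleftrightarrow> v \<noteq> 0 \<and> (\<exists>k. k \<noteq> 0 \<and> w = k *s v)"

quotient_type (overloaded) 'a proj_line = "('a::field)^2" / partial: proportional
proof (rule part_equivpI)
  have "proportional (1 :: 'a^2) 1"
    unfolding proportional_def by (auto intro!: exI[of _ "1::'a"])
  then show "\<exists>v :: 'a^2. proportional v v" ..
  show "symp (proportional :: 'a^2 \<Rightarrow> _)"
  proof (rule sympI)
    fix v w :: "'a^2"
    assume "proportional v w"
    then obtain k where k: "v \<noteq> 0" "k \<noteq> 0" "w = k *s v"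
      unfolding proportional_def by blast
    then have "v = inverse k *s w" "w \<noteq> 0" by (auto simp: vec_eq_iff)
    with k show "proportional w v"
      unfolding proportional_def by (metis nonzero_imp_inverse_nonzero)
  qed
  show "transp (proportional :: 'a^2 \<Rightarrow> _)"
  proof (rule transpI)
    fix u v w :: "'a^2"
    assume "proportional u v" "proportional v w"
    then obtain k l where "u \<noteq> 0" "k \<noteq> 0" "l \<noteq> 0" "w = (l * k) *s u"
      unfolding proportional_def by (auto simp: vec_eq_iff)
    then show "proportional u w"
      unfolding proportional_def by (metis mult_eq_0_iff)
  qed
qed

definition gl2_proportional :: "'a::field^2^2 \<Rightarrow> 'a^2^2 \<Rightarrow> bool" where
  "gl2_proportional A B \<longleftrightarrow> invertible A \<and> (\<exists>k. k \<noteq> 0 \<and> B = mat k ** A)"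

lemma mat_mult_entry: "(mat k ** A) $ i $ j = k * (A :: 'a::comm_ring_1^2^2) $ i $ j"
  by (simp add: matrix_matrix_mult_def mat_def if_distrib[of "\<lambda>x. x * _"] sum.delta' cong: if_cong)

lemma mat_mult_commute: "mat k ** A = A ** mat k" for A :: "'a::comm_ring_1^2^2"
  by (simp add: vec_eq_iff matrix_matrix_mult_def mat_def if_distrib[of "\<lambda>x. x * _"]
      if_distrib[of "\<lambda>x. _ * x"] sum.delta sum.delta' mult.commute cong: if_cong)

lemma mat_mult_mat: "mat k ** mat l = (mat (k * l) :: 'a::comm_ring_1^2^2)"
  by (auto simp: vec_eq_iff mat_mult_entry) (auto simp: mat_def)

lemma invertible_mat_scalar: "k \<noteq> 0 \<Longrightarrow> invertible (mat k :: 'a::field^2^2)"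
  unfolding invertible_def by (rule exI[of _ "mat (inverse k)"]) (simp add: mat_mult_mat)

quotient_type (overloaded) 'a pgl2 = "('a::field)^2^2" / partial: gl2_proportional
proof (rule part_equivpI)
  have "gl2_proportional (mat 1 :: 'a^2^2) (mat 1)"
    unfolding gl2_proportional_def
    by (auto simp: invertible_mat_scalar intro!: exI[of _ "1::'a"])
  then show "\<exists>A :: 'a^2^2. gl2_proportional A A" ..
  show "symp (gl2_proportional :: 'a^2^2 \<Rightarrow> _)"
  proof (rule sympI)
    fix A B :: "'a^2^2"
    assume "gl2_proportional A B"
    then obtain k where k: "invertible A" "k \<noteq> 0" "B = mat k ** A"
      unfolding gl2_proportional_def by blast
    then have "A = mat (inverse k) ** B" by (simp add: matrix_mul_assoc mat_mult_mat)
    moreover have "invertible B" using k by (simp add: invertible_mult invertible_mat_scalar)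
    ultimately show "gl2_proportional B A"
      unfolding gl2_proportional_def using k(2) by (metis nonzero_imp_inverse_nonzero)
  qed
  show "transp (gl2_proportional :: 'a^2^2 \<Rightarrow> _)"
  proof (rule transpI)
    fix A B C :: "'a^2^2"
    assume "gl2_proportional A B" "gl2_proportional B C"
    then obtain k l where "invertible A" "k \<noteq> 0" "l \<noteq> 0" "C = mat (l * k) ** A"
      unfolding gl2_proportional_def by (auto simp: matrix_mul_assoc mat_mult_mat)
    then show "gl2_proportional A C"
      unfolding gl2_proportional_def by (metis mult_eq_0_iff)
  qed
qed

lemma invertible_matrix_inv:
  assumes "invertible (A :: 'a::field^2^2)"
  shows "A ** matrix_inv A = mat 1" "matrix_inv A ** A = mat 1" "invertible (matrix_inv A)"
proof -
  show 1: "A ** matrix_inv A = mat 1" and 2: "matrix_inv A ** A = mat 1"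
    using someI_ex[OF assms[unfolded invertible_def]] unfolding matrix_inv_def by auto
  show "invertible (matrix_inv A)"
    unfolding invertible_def using 1 2 by blast
qed

lift_definition pgl_apply :: "'a::field pgl2 \<Rightarrow> 'a proj_line \<Rightarrow> 'a proj_line"
  is "\<lambda>A v. A *v v"
proof -
  fix A B :: "'a^2^2" and v w :: "'a^2"
  assume "gl2_proportional A B" "proportional v w"
  then obtain k l where kl: "invertible A" "k \<noteq> 0" "B = mat k ** A"
    "v \<noteq> 0" "l \<noteq> 0" "w = l *s v"
    unfolding gl2_proportional_def proportional_def by blast
  have "A *v v \<noteq> 0"
  proof
    assume "A *v v = 0"
    then have "matrix_inv A ** A *v v = 0"
      by (metis matrix_vector_mul_assoc matrix_vector_mult_0_right)
    with kl show False by (simp add: invertible_matrix_inv)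
  qed
  moreover have "B *v w = (k * l) *s (A *v v)"
    using kl by (simp add: vec_eq_iff matrix_vector_mult_def mat_mult_entry sum_distrib_left algebra_simps)
  ultimately show "proportional (A *v v) (B *v w)"
    unfolding proportional_def using kl by (metis mult_eq_0_iff)
qed

lift_definition pgl_mult :: "'a::field pgl2 \<Rightarrow> 'a pgl2 \<Rightarrow> 'a pgl2" is "\<lambda>A B. A ** B"
proof -
  fix A A' B B' :: "'a^2^2"
  assume "gl2_proportional A A'" "gl2_proportional B B'"
  then obtain k l where kl: "invertible A" "k \<noteq> 0" "A' = mat k ** A"
    "invertible B" "l \<noteq> 0" "B' = mat l ** B"
    unfolding gl2_proportional_def by blast
  have "A' ** B' = mat (k * l) ** (A ** B)"
    unfolding kl(3,6) by (metis mat_mult_commute mat_mult_mat matrix_mul_assoc)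
  then show "gl2_proportional (A ** B) (A' ** B')"
    unfolding gl2_proportional_def using kl by (metis invertible_mult mult_eq_0_iff)
qed

lift_definition pgl_inv :: "'a::field pgl2 \<Rightarrow> 'a pgl2" is matrix_inv
proof -
  fix A B :: "'a^2^2"
  assume "gl2_proportional A B"
  then obtain k where k: "invertible A" "k \<noteq> 0" "B = mat k ** A"
    unfolding gl2_proportional_def by blast
  then have B: "invertible B" by (simp add: invertible_mult invertible_mat_scalar)
  have "(mat (inverse k) ** matrix_inv A) ** B = mat 1"
  proof -
    have "(mat (inverse k) ** matrix_inv A) ** B
        = mat (inverse k) ** ((matrix_inv A ** mat k) ** A)"
      unfolding k(3) by (simp add: matrix_mul_assoc)
    also have "\<dots> = mat (inverse k) ** mat k ** (matrix_inv A ** A)"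
      by (metis mat_mult_commute matrix_mul_assoc)
    finally show ?thesis using k by (simp add: mat_mult_mat invertible_matrix_inv)
  qed
  then have "matrix_inv B = mat (inverse k) ** matrix_inv A"
    by (metis B invertible_matrix_inv(1) matrix_mul_assoc matrix_mul_lid matrix_mul_rid)
  then show "gl2_proportional (matrix_inv A) (matrix_inv B)"
    unfolding gl2_proportional_def using k invertible_matrix_inv(3)[OF k(1)]
    by (metis nonzero_imp_inverse_nonzero)
qed

text \<open>In homogeneous coordinates the difference \<open>a - b\<close> becomes the determinant of \<open>a\<close> and \<open>b\<close>;
  on the points \<open>(x, 1)\<close> the formula below is \<open>(a-c)/(a-d) * ((b-d)/(b-c))\<close>.\<close>

definition bracket :: "'a::field^2 \<Rightarrow> 'a^2 \<Rightarrow> 'a" where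
  "bracket v w = v $ 1 * w $ 2 - w $ 1 * v $ 2"

lemma bracket_scale: "bracket (k *s v) (l *s w) = k * l * bracket v w"
  by (simp add: bracket_def algebra_simps)

lift_definition cross_ratio ::
    "'a::field proj_line \<Rightarrow> 'a proj_line \<Rightarrow> 'a proj_line \<Rightarrow> 'a proj_line \<Rightarrow> 'a"
  is "\<lambda>a b c d. bracket a c / bracket a d * (bracket b d / bracket b c)"
  unfolding proportional_def by (auto simp: bracket_scale)

text \<open>The projective transformation \<open>h\<close> with \<open>[a, h a, b, d] = q\<close>, where \<open>q \<noteq> 0\<close> and \<open>b \<noteq> d\<close>; the
  cross-ratio degenerates at \<open>b\<close> and \<open>d\<close>, which are its fixed points.  For \<open>a\<close> different from both,
  division by zero makes the cross-ratio \<open>0 \<noteq> q\<close> at \<open>c = b\<close> and at \<open>c = d\<close>, so that the solution \<open>c\<close>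
  is unique.\<close>

definition h_map :: "'a::field \<Rightarrow> 'a proj_line \<Rightarrow> 'a proj_line \<Rightarrow> 'a proj_line \<Rightarrow> 'a proj_line" where
  "h_map q b d a = (if a = b \<or> a = d then a else (THE c. cross_ratio a c b d = q))"


section \<open>Twisted polygons, their moduli space and the flips\<close>

type_synonym 'a polygon = "(int \<Rightarrow> 'a proj_line) \<times> 'a pgl2"

definition ngons :: "nat \<Rightarrow> 'a::field polygon set" where
  "ngons n = {(p, M). (\<forall>i. p (i + int n) = pgl_apply M (p i)) \<and>
     (\<forall>i. p i \<noteq> p (i + 1) \<and> p (i + 1) \<noteq> p (i + 2) \<and> p i \<noteq> p (i + 2))}"

definition pgl_act :: "'a::field pgl2 \<Rightarrow> 'a polygon \<Rightarrow> 'a polygon" where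
  "pgl_act A = (\<lambda>(p, M). (\<lambda>i. pgl_apply A (p i), pgl_mult (pgl_mult A M) (pgl_inv A)))"

definition polygon_moduli :: "nat \<Rightarrow> 'a::field polygon set set" where
  "polygon_moduli n = ngons n // {(P, Q). P \<in> ngons n \<and> Q \<in> ngons n \<and> (\<exists>A. Q = pgl_act A P)}"

definition curvatures :: "nat \<Rightarrow> (int \<Rightarrow> 'a::field) set" where
  "curvatures n = {\<mu>. \<forall>i. \<mu> i \<noteq> 0 \<and> \<mu> (i + int n) = \<mu> i}"

type_synonym 'a enriched = "'a polygon set \<times> (int \<Rightarrow> 'a)"

definition enriched_moduli :: "nat \<Rightarrow> 'a::field enriched set" where
  "enriched_moduli n = polygon_moduli n \<times> curvatures n"

text \<open>The coordinate \<open>c i\<close> of a polygon, and of a class of polygons (on which it is constant).\<close>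

definition polygon_cr :: "'a::field polygon \<Rightarrow> int \<Rightarrow> 'a" where
  "polygon_cr P i = cross_ratio (fst P i) (fst P (i + 1)) (fst P (i - 1)) (fst P (i + 2))"

definition class_cr :: "'a::field polygon set \<Rightarrow> int \<Rightarrow> 'a" where
  "class_cr C i = the_elem ((\<lambda>P. polygon_cr P i) ` C)"

definition flip_polygon :: "nat \<Rightarrow> int \<Rightarrow> (int \<Rightarrow> 'a::field) \<Rightarrow> 'a polygon \<Rightarrow> 'a polygon" where
  "flip_polygon n j \<mu> = (\<lambda>(p, M).
     (\<lambda>i. if i mod int n = j mod int n
          then h_map (\<mu> i / \<mu> (i - 1)) (p (i + 1)) (p (i - 1)) (p i) else p i, M))"

definition flip_curvature :: "nat \<Rightarrow> int \<Rightarrow> (int \<Rightarrow> 'a) \<Rightarrow> (int \<Rightarrow> 'a)" where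
  "flip_curvature n j \<mu> = (\<lambda>i.
     if i mod int n = j mod int n then \<mu> (i - 1)
     else if (i + 1) mod int n = j mod int n then \<mu> (i + 1) else \<mu> i)"

text \<open>The flip on the moduli space.  It is a partial map: the flipped polygon may violate the
  distinctness condition.  Flips commute with \<open>PGL\<^sub>2\<close>, so the image of a class is a class.\<close>

definition flip :: "nat \<Rightarrow> int \<Rightarrow> 'a::field enriched \<Rightarrow> 'a enriched option" where
  "flip n j = (\<lambda>(C, \<mu>). let C' = flip_polygon n j \<mu> ` C in
     if C' \<in> polygon_moduli n then Some (C', flip_curvature n j \<mu>) else None)"


section \<open>Scaling symmetries\<close>

text \<open>A rational map from \<open>G\<^sub>m\<close> times the moduli space to the moduli space, defined over a field
  \<open>'f\<close>, in the coordinates \<open>t\<close> (\<open>Param\<close>), \<open>c i\<close> (\<open>Cross i\<close>) and \<open>\<mu> i\<close> (\<open>Curv i\<close>), where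
  \<open>0 \<le> i < n\<close>: each coordinate of the image is a fraction of two polynomials.  Polynomials are
  represented by expressions, which can be evaluated at points with coordinates in any field
  extension \<open>\<iota> :: 'f \<Rightarrow> 'k\<close>.\<close>

datatype coord = Param | Cross int | Curv int

datatype 'f pexp = Const 'f | Var coord | Add "'f pexp" "'f pexp" | Mult "'f pexp" "'f pexp"

primrec peval :: "('f \<Rightarrow> 'k::field) \<Rightarrow> (coord \<Rightarrow> 'k) \<Rightarrow> 'f pexp \<Rightarrow> 'k" where
  "peval \<iota> v (Const a) = \<iota> a"
| "peval \<iota> v (Var x) = v x"
| "peval \<iota> v (Add e f) = peval \<iota> v e + peval \<iota> v f"
| "peval \<iota> v (Mult e f) = peval \<iota> v e * peval \<iota> v f"

record 'f rational_map =
  num :: "coord \<Rightarrow> 'f pexp"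
  den :: "coord \<Rightarrow> 'f pexp"

primrec valuation :: "'k::field \<Rightarrow> 'k enriched \<Rightarrow> coord \<Rightarrow> 'k" where
  "valuation t x Param = t"
| "valuation t x (Cross i) = class_cr (fst x) i"
| "valuation t x (Curv i) = snd x i"

definition maps_to ::
    "('f \<Rightarrow> 'k::field) \<Rightarrow> nat \<Rightarrow> 'f rational_map \<Rightarrow> 'k \<Rightarrow> 'k enriched \<Rightarrow> 'k enriched \<Rightarrow> bool" where
  "maps_to \<iota> n R t x y \<longleftrightarrow> t \<noteq> 0 \<and> x \<in> enriched_moduli n \<and> y \<in> enriched_moduli n \<and>
     (\<forall>z \<in> Cross ` {0..<int n} \<union> Curv ` {0..<int n}.
        peval \<iota> (valuation t x) (den R z) \<noteq> 0 \<and>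
        valuation t y z = peval \<iota> (valuation t x) (num R z) / peval \<iota> (valuation t x) (den R z))"

definition apply_map ::
    "('f \<Rightarrow> 'k::field) \<Rightarrow> nat \<Rightarrow> 'f rational_map \<Rightarrow> 'k \<Rightarrow> 'k enriched \<Rightarrow> 'k enriched option" where
  "apply_map \<iota> n R t x =
     (if \<exists>!y. maps_to \<iota> n R t x y then Some (THE y. maps_to \<iota> n R t x y) else None)"

definition partial_action ::
    "nat \<Rightarrow> ('k::field \<Rightarrow> 'k enriched \<Rightarrow> 'k enriched option) \<Rightarrow> bool" where
  "partial_action n \<rho> \<longleftrightarrow>
     (\<forall>x \<in> enriched_moduli n. \<rho> 1 x = Some x) \<and>
     (\<forall>x \<in> enriched_moduli n. \<forall>y s t. s \<noteq> 0 \<longrightarrow> t \<noteq> 0 \<longrightarrow>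
        \<rho> t x = Some y \<longrightarrow> \<rho> s y = \<rho> (s * t) x)"

text \<open>Equality of partial maps: both sides are undefined at the same points.\<close>

definition commutes_with_flips ::
    "nat \<Rightarrow> ('k::field \<Rightarrow> 'k enriched \<Rightarrow> 'k enriched option) \<Rightarrow> bool" where
  "commutes_with_flips n \<rho> \<longleftrightarrow>
     (\<forall>x \<in> enriched_moduli n. \<forall>t j. t \<noteq> 0 \<longrightarrow>
        Option.bind (\<rho> t x) (flip n j) = Option.bind (flip n j x) (\<rho> t))"

definition nontrivial_action ::
    "nat \<Rightarrow> ('k::field \<Rightarrow> 'k enriched \<Rightarrow> 'k enriched option) \<Rightarrow> bool" where
  "nontrivial_action n \<rho> \<longleftrightarrow>
     (\<exists>x \<in> enriched_moduli n. \<exists>y t. t \<noteq> 0 \<and> \<rho> t x = Some y \<and> y \<noteq> x)"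

definition generic_ext :: "'f::field \<Rightarrow> 'f poly fract" where
  "generic_ext a = to_fract [:a:]"

text \<open>The acting group is the algebraic group \<open>G\<^sub>m\<close> over the base field \<open>F\<close>, not just the abstract
  group \<open>F\<^sup>*\<close> (which is trivial for the field with two elements).  The conditions are therefore
  imposed on the points over \<open>F\<close> and on those over the rational function field \<open>F(X)\<close>: the latter
  is infinite, so its points are dense and decide identities between rational maps over \<open>F\<close>,
  in particular whether the action is trivial.\<close>

definition scaling_symmetry :: "nat \<Rightarrow> 'f::field rational_map \<Rightarrow> bool" where
  "scaling_symmetry n R \<longleftrightarrow>
     partial_action n (apply_map id n R) \<and> commutes_with_flips n (apply_map id n R) \<and>
     partial_action n (apply_map generic_ext n R) \<and>
     commutes_with_flips n (apply_map generic_ext n R) \<and>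
     nontrivial_action n (apply_map generic_ext n R)"

definition acts_by_scaling ::
    "nat \<Rightarrow> 'k::field \<Rightarrow> ('k \<Rightarrow> 'k enriched \<Rightarrow> 'k enriched option) \<Rightarrow> bool" where
  "acts_by_scaling n \<eta> \<rho> \<longleftrightarrow>
     (\<forall>t C \<mu>. t \<noteq> 0 \<longrightarrow> (C, \<mu>) \<in> enriched_moduli n \<longrightarrow>
        (\<rho> t (C, \<mu>) \<noteq> None \<longleftrightarrow> (\<forall>i. t \<noteq> 1 - inverse (\<eta> * \<mu> i))) \<and>
        (\<forall>C' \<mu>'. \<rho> t (C, \<mu>) = Some (C', \<mu>') \<longrightarrow>
           (\<forall>i. \<mu>' i = t * \<mu> i / (1 + (t - 1) * \<eta> * \<mu> i) \<and>
                class_cr C' i = class_cr C i * (t * \<mu> i / \<mu>' i))))"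

end

theory Submission
  imports Defs
begin

text \<open>
The cross-ratio coordinates identify the moduli space of twisted polygons with the set of
nowhere vanishing \<open>n\<close>-periodic sequences \<open>c\<close>: three consecutive vertices can be placed
anywhere by \<open>PGL\<^sub>2\<close>, after which \<open>c\<close> determines all other vertices, in both directions, and
periodicity of \<open>c\<close> provides the monodromy (\<open>polygon_moduli_eq\<close>, \<open>class_cr_fibre\<close>).
The statement thus becomes one about pairs of sequences \<open>(c, \<mu>)\<close>.

In these coordinates the flip at \<open>j\<close> is explicit.  For \<open>i\<close> congruent to \<open>j\<close> put
\<open>q\<^sub>i = \<mu>\<^sub>i / \<mu>\<^bsub>i-1\<^esub>\<close>, \<open>u\<^sub>i = 1 + (q\<^sub>i - 1) c\<^sub>i\<close> and
\<open>w\<^sub>i = q\<^sub>i + (1 - q\<^sub>i) c\<^bsub>i-1\<^esub>\<close>.  For a suitable choice of homogeneous coordinates, replacing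
\<open>p\<^sub>i\<close> by its flipped position multiplies the brackets of \<open>p\<^sub>i\<close> with
\<open>p\<^bsub>i+1\<^esub>\<close>, \<open>p\<^bsub>i-1\<^esub>\<close>, \<open>p\<^bsub>i+2\<^esub>\<close>, \<open>p\<^bsub>i-2\<^esub>\<close> by \<open>1\<close>, \<open>q\<^sub>i\<close>, \<open>u\<^sub>i\<close>, \<open>w\<^sub>i\<close>
(\<open>h_map_brackets\<close>).  So the flip is defined exactly when \<open>u\<^sub>j\<close> and \<open>w\<^sub>j\<close> do not vanish, and
every cross-ratio changes by a monomial in \<open>q\<close>, \<open>u\<close> and \<open>w\<close> (\<open>flip_point\<close>).  As \<open>n \<ge> 3\<close>,
each bracket in a coordinate contains at most one flipped vertex; this covers \<open>n = 3\<close>, where a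
single coordinate may involve two of them.

Put \<open>D\<^sub>i = 1 + (t - 1) \<eta> \<mu>\<^sub>i\<close>.  The scaling is \<open>c\<^sub>i \<mapsto> c\<^sub>i D\<^sub>i\<close>, \<open>\<mu>\<^sub>i \<mapsto> t \<mu>\<^sub>i / D\<^sub>i\<close>.  It is an
action because \<open>1 / \<mu>\<^sub>i - \<eta>\<close> is divided by \<open>t\<close>.  It commutes with the flips because of the identity
\<open>q\<^sub>i D\<^bsub>i-1\<^esub> - D\<^sub>i = q\<^sub>i - 1\<close>: it shows that \<open>u\<^sub>i\<close> is invariant, whereas \<open>q\<^sub>i\<close> and \<open>w\<^sub>i\<close> are
both multiplied by \<open>D\<^bsub>i-1\<^esub> / D\<^sub>i\<close>.  In the monomials these factors combine to the exchange
of \<open>D\<^bsub>i-1\<^esub>\<close> and \<open>D\<^sub>i\<close>, which is what exchanging \<open>\<mu>\<^bsub>i-1\<^esub>\<close> and \<open>\<mu>\<^sub>i\<close> requires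
(\<open>flip_scale_commute\<close>).
\<close>

section \<open>Brackets of points of the projective line\<close>

text \<open>Brackets of points depend on the chosen representatives.  They are used only in expressions in
which the representatives cancel, or up to a common scaling factor of each point.\<close>

definition br :: "'a::field proj_line \<Rightarrow> 'a proj_line \<Rightarrow> 'a" where
  "br p q = bracket (rep_proj_line p) (rep_proj_line q)"

lemma proportional_refl_iff: "proportional v v \<longleftrightarrow> v \<noteq> 0"
  unfolding proportional_def by (metis vector_smult_lid one_neq_zero)

lemma rep_proj_line_nonzero: "rep_proj_line p \<noteq> 0"
  using Quotient_rep_reflp[OF Quotient_proj_line] proportional_refl_iff by blast

lemma abs_rep_proj_line [simp]: "abs_proj_line (rep_proj_line p) = p"
  using Quotient_abs_rep[OF Quotient_proj_line] .

lemma abs_proj_line_eq_iff: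
  "v \<noteq> 0 \<Longrightarrow> w \<noteq> 0 \<Longrightarrow> abs_proj_line v = abs_proj_line w \<longleftrightarrow> (\<exists>k. k \<noteq> 0 \<and> w = k *s v)"
  using Quotient_rel[OF Quotient_proj_line, of v w] proportional_refl_iff
  unfolding proportional_def by blast

lemma rep_abs_proj_line: "v \<noteq> 0 \<Longrightarrow> \<exists>k. k \<noteq> 0 \<and> rep_proj_line (abs_proj_line v) = k *s v"
  using abs_proj_line_eq_iff[of v "rep_proj_line (abs_proj_line v)"]
  by (simp add: rep_proj_line_nonzero)

lemma bracket_eq_0_iff:
  assumes "v \<noteq> 0" "w \<noteq> 0"
  shows "bracket v w = 0 \<longleftrightarrow> (\<exists>k. k \<noteq> 0 \<and> w = k *s v)"
proof
  assume b: "bracket v w = 0"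
  show "\<exists>k. k \<noteq> 0 \<and> w = k *s v"
  proof (cases "v $ 1 = 0")
    case True
    then have "v $ 2 \<noteq> 0" using assms by (auto simp: vec_eq_iff forall_2)
    moreover from this have "w $ 1 = 0" using b True by (simp add: bracket_def)
    ultimately show ?thesis using assms True
      by (intro exI[of _ "w $ 2 / v $ 2"]) (auto simp: vec_eq_iff forall_2)
  next
    case False
    then have "w $ 2 = w $ 1 * v $ 2 / v $ 1" using b by (simp add: bracket_def field_simps)
    with False assms show ?thesis
      by (intro exI[of _ "w $ 1 / v $ 1"]) (auto simp: vec_eq_iff forall_2)
  qed
next
  assume "\<exists>k. k \<noteq> 0 \<and> w = k *s v"
  then show "bracket v w = 0" by (auto simp: bracket_def)
qed

lemma br_eq_0_iff [simp]: "br p q = 0 \<longleftrightarrow> p = q"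
  unfolding br_def
  using bracket_eq_0_iff[OF rep_proj_line_nonzero rep_proj_line_nonzero, of p q]
    abs_proj_line_eq_iff[OF rep_proj_line_nonzero rep_proj_line_nonzero, of p q] by simp

lemma br_self [simp]: "br p p = 0"
  by simp

lemma br_swap: "br q p = - br p q"
  by (simp add: br_def bracket_def)

lemma br_pluecker: "br a b * br d e = br a d * br b e - br a e * br b d"
  by (simp add: br_def bracket_def algebra_simps)

lemma cross_ratio_br: "cross_ratio a b c d = br a c / br a d * (br b d / br b c)"
proof -
  have "cross_ratio (abs_proj_line (rep_proj_line a)) (abs_proj_line (rep_proj_line b))
      (abs_proj_line (rep_proj_line c)) (abs_proj_line (rep_proj_line d))
    = br a c / br a d * (br b d / br b c)"
    unfolding br_def
    by (rule cross_ratio.abs_eq) (simp_all add: proportional_refl_iff rep_proj_line_nonzero)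
  then show ?thesis by simp
qed

text \<open>Every point is reached by a linear combination of representatives; the factor \<open>k\<close> relates this
vector to the representative of the point.\<close>

lemma combination_point:
  assumes "a \<noteq> b" "x \<noteq> 0 \<or> y \<noteq> 0"
  obtains d k where "k \<noteq> 0" "\<And>e. br d e = k * (x * br a e + y * br b e)"
proof -
  define v where "v = x *s rep_proj_line a + y *s rep_proj_line b"
  have v: "bracket v w = x * bracket (rep_proj_line a) w + y * bracket (rep_proj_line b) w" for w
    by (simp add: v_def bracket_def algebra_simps)
  have "v \<noteq> 0"
  proof
    assume "v = 0"
    then have "bracket v (rep_proj_line a) = 0" "bracket v (rep_proj_line b) = 0"
      by (simp_all add: bracket_def)
    then have "y * br b a = 0" "x * br a b = 0"
      unfolding v br_def by (simp_all add: bracket_def)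
    with assms show False by auto
  qed
  then obtain k where k: "k \<noteq> 0" "rep_proj_line (abs_proj_line v) = k *s v"
    using rep_abs_proj_line by blast
  show thesis
  proof (rule that[OF k(1)])
    show "br (abs_proj_line v) e = k * (x * br a e + y * br b e)" for e
      using v[of "rep_proj_line e"] bracket_scale[of k v 1 "rep_proj_line e"]
      unfolding br_def k(2) by simp
  qed
qed

lemma cross_ratio_swap: "cross_ratio b a d c = cross_ratio a b c d"
  by (simp add: cross_ratio_br mult.commute)

text \<open>By the Pluecker relation, equality of the two cross-ratios means that the product of the brackets
of \<open>a, b\<close> and of \<open>d, e\<close> vanishes.\<close>

lemma cross_ratio_inject:
  assumes "a \<noteq> b" "a \<noteq> c" "b \<noteq> c" "d \<noteq> a" "d \<noteq> b" "e \<noteq> a" "e \<noteq> b"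
    and eq: "cross_ratio a b c d = cross_ratio a b c e"
  shows "d = e"
proof -
  have "br b d * br a e = br b e * br a d"
    using eq assms(1-7) by (simp add: cross_ratio_br field_simps)
  then have "br a b * br d e = 0"
    using br_pluecker[of a b d e] by (simp add: mult.commute)
  with \<open>a \<noteq> b\<close> show ?thesis by simp
qed

lemma cross_ratio_surj:
  assumes "a \<noteq> b" "a \<noteq> c" "b \<noteq> c" "q \<noteq> 0"
  obtains d where "d \<noteq> a" "d \<noteq> b" "cross_ratio a b c d = q"
proof -
  obtain d k where k: "k \<noteq> 0"
    and d: "\<And>e. br d e = k * (q * br b c * br a e + (- br a c) * br b e)"
    by (rule combination_point[OF \<open>a \<noteq> b\<close>, of "q * br b c" "- br a c"]) (use assms in auto)
  have da: "br d a = k * br a c * br a b" and db: "br d b = k * q * br b c * br a b"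
    using d[of a] d[of b] br_swap[of b a] by simp_all
  have "d \<noteq> a" "d \<noteq> b" using da db k assms by (auto simp flip: br_eq_0_iff)
  moreover have "cross_ratio a b c d = q"
    unfolding cross_ratio_br br_swap[of a d] br_swap[of b d] da db
    using k assms by (simp add: field_simps)
  ultimately show thesis by (rule that)
qed

section \<open>Projective transformations\<close>

lemma gl2_proportional_refl_iff: "gl2_proportional A A \<longleftrightarrow> invertible A"
proof -
  have "A = mat 1 ** A" by simp
  then show ?thesis unfolding gl2_proportional_def by (metis one_neq_zero)
qed

lemma pgl_cases:
  obtains A where "invertible A" "M = abs_pgl2 A"
  using Quotient_abs_rep[OF Quotient_pgl2] Quotient_rep_reflp[OF Quotient_pgl2]
    gl2_proportional_refl_iff by metis

lemma abs_pgl2_eqI: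
  "invertible A \<Longrightarrow> k \<noteq> 0 \<Longrightarrow> B = mat k ** A \<Longrightarrow> abs_pgl2 A = abs_pgl2 B"
  using Quotient_rel_abs[OF Quotient_pgl2, of A B] unfolding gl2_proportional_def by blast

lemma invertible_mult_nonzero:
  assumes "invertible (A :: 'a::field^2^2)" "v \<noteq> 0"
  shows "A *v v \<noteq> 0"
  using assms
  by (metis invertible_matrix_inv(2) matrix_vector_mul_assoc matrix_vector_mul_lid
      matrix_vector_mult_0_right)

lemma pgl_apply_abs:
  "invertible A \<Longrightarrow> v \<noteq> 0 \<Longrightarrow> pgl_apply (abs_pgl2 A) (abs_proj_line v) = abs_proj_line (A *v v)"
  by (rule pgl_apply.abs_eq) (simp_all add: gl2_proportional_refl_iff proportional_refl_iff)

lemma pgl_apply_mult: "pgl_apply (pgl_mult A B) p = pgl_apply A (pgl_apply B p)"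
proof -
  obtain A' where A: "invertible A'" "A = abs_pgl2 A'" by (rule pgl_cases)
  obtain B' where B: "invertible B'" "B = abs_pgl2 B'" by (rule pgl_cases)
  have "pgl_mult A B = abs_pgl2 (A' ** B')"
    unfolding A(2) B(2) by (rule pgl_mult.abs_eq) (simp_all add: gl2_proportional_refl_iff A B)
  then have "pgl_apply (pgl_mult A B) (abs_proj_line (rep_proj_line p))
      = pgl_apply A (pgl_apply B (abs_proj_line (rep_proj_line p)))"
    using A B
    by (simp add: pgl_apply_abs rep_proj_line_nonzero invertible_mult invertible_mult_nonzero
        matrix_vector_mul_assoc del: abs_rep_proj_line)
  then show ?thesis by simp
qed

lemma pgl_apply_inv: "pgl_apply (pgl_inv A) (pgl_apply A p) = p"
proof -
  obtain A' where A: "invertible A'" "A = abs_pgl2 A'" by (rule pgl_cases)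
  have "pgl_inv A = abs_pgl2 (matrix_inv A')"
    unfolding A(2) by (rule pgl_inv.abs_eq) (simp add: gl2_proportional_refl_iff A)
  then have "pgl_apply (pgl_inv A) (pgl_apply A (abs_proj_line (rep_proj_line p))) = p"
    using A
    by (simp add: pgl_apply_abs rep_proj_line_nonzero invertible_mult_nonzero
        invertible_matrix_inv matrix_vector_mul_assoc del: abs_rep_proj_line) simp
  then show ?thesis by simp
qed

lemma pgl_apply_eq_iff [simp]: "pgl_apply A p = pgl_apply A q \<longleftrightarrow> p = q"
  by (metis pgl_apply_inv)

lemma bracket_mult: "bracket (A *v v) (A *v w) = det A * bracket v w"
  by (simp add: bracket_def matrix_vector_mult_def sum_2 det_2 algebra_simps)

text \<open>The determinant of a matrix and the factors that relate images of representatives to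
representatives of images: all of them cancel in cross-ratios.\<close>

lemma br_pgl_apply:
  fixes A :: "'a::field pgl2"
  obtains D :: 'a and k where "D \<noteq> 0" "\<And>p. k p \<noteq> 0"
    "\<And>p q. br (pgl_apply A p) (pgl_apply A q) = D * k p * k q * br p q"
proof -
  obtain A' where A: "invertible A'" "A = abs_pgl2 A'" by (rule pgl_cases)
  have "\<exists>k. k \<noteq> 0 \<and> rep_proj_line (pgl_apply A p) = k *s (A' *v rep_proj_line p)" for p
    using rep_abs_proj_line[OF invertible_mult_nonzero[OF A(1) rep_proj_line_nonzero, of p]]
      pgl_apply_abs[OF A(1) rep_proj_line_nonzero, of p] A(2) by simp
  then obtain k where k: "k p \<noteq> 0" "rep_proj_line (pgl_apply A p) = k p *s (A' *v rep_proj_line p)"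
    for p by metis
  show thesis
  proof (rule that[of "det A'" k])
    show "det A' \<noteq> 0" using A(1) invertible_det_nz by blast
    show "k p \<noteq> 0" for p by (rule k)
    show "br (pgl_apply A p) (pgl_apply A q) = det A' * k p * k q * br p q" for p q
      unfolding br_def k(2) bracket_scale bracket_mult by (simp add: algebra_simps)
  qed
qed

lemma cross_ratio_pgl_apply [simp]:
  "cross_ratio (pgl_apply A a) (pgl_apply A b) (pgl_apply A c) (pgl_apply A d)
    = cross_ratio a b c d"
  by (rule br_pgl_apply[of A]) (simp add: cross_ratio_br)

text \<open>The linear map \<open>x \<mapsto> \<alpha> [x, b] a' + \<beta> [x, a] b'\<close> sends \<open>a\<close> to \<open>a'\<close> and \<open>b\<close> to \<open>b'\<close>.  The expansion of
\<open>c'\<close> in the basis \<open>a', b'\<close> dictates the values of \<open>\<alpha>\<close> and \<open>\<beta>\<close> for which it sends \<open>c\<close> to \<open>c'\<close>.\<close>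

lemma pgl_three_transitive:
  assumes "a \<noteq> b" "a \<noteq> c" "b \<noteq> c" "a' \<noteq> b'" "a' \<noteq> c'" "b' \<noteq> c'"
  obtains A where "pgl_apply A a = a'" "pgl_apply A b = b'" "pgl_apply A c = c'"
proof -
  define v w v' w' where vw: "v = rep_proj_line a" "w = rep_proj_line b"
    "v' = rep_proj_line a'" "w' = rep_proj_line b'"
  define \<alpha> \<beta> where ab: "\<alpha> = br c' b' / br c b" "\<beta> = br a' c' / br c a"
  define A :: "'a^2^2" where "A = (\<chi> r s. if s = 1
      then \<alpha> * v' $ r * w $ 2 + \<beta> * w' $ r * v $ 2
      else - (\<alpha> * v' $ r * w $ 1 + \<beta> * w' $ r * v $ 1))"
  have nz: "\<alpha> \<noteq> 0" "\<beta> \<noteq> 0" using assms by (auto simp: ab)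
  have A: "A *v x = (\<alpha> * bracket x w) *s v' + (\<beta> * bracket x v) *s w'" for x
    by (simp add: A_def vec_eq_iff matrix_vector_mult_def sum_2 bracket_def algebra_simps forall_2)
  have "det A = - (\<alpha> * \<beta> * bracket v w * bracket v' w')"
    by (simp add: A_def det_2 bracket_def algebra_simps)
  also have "\<dots> \<noteq> 0" using nz assms unfolding vw br_def[symmetric] by simp
  finally have inv: "invertible A" by (simp add: invertible_det_nz)
  have "pgl_apply (abs_pgl2 A) p = q" if "bracket (A *v rep_proj_line p) (rep_proj_line q) = 0" for p q
  proof -
    have "pgl_apply (abs_pgl2 A) (abs_proj_line (rep_proj_line p)) = abs_proj_line (rep_proj_line q)"
      unfolding pgl_apply_abs[OF inv rep_proj_line_nonzero]
      using that bracket_eq_0_iff[of "A *v rep_proj_line p" "rep_proj_line q"]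
        abs_proj_line_eq_iff[of "A *v rep_proj_line p" "rep_proj_line q"]
        invertible_mult_nonzero[OF inv rep_proj_line_nonzero] rep_proj_line_nonzero by blast
    then show ?thesis by simp
  qed
  note * = this[unfolded A]
  have br: "bracket (x *s y + z *s u) s = x * bracket y s + z * bracket u s"
    "bracket (x *s y) s = x * bracket y s" for x z :: 'a and y u s
    by (simp_all add: bracket_def algebra_simps)
  show thesis
  proof (rule that[of "abs_pgl2 A"])
    show "pgl_apply (abs_pgl2 A) a = a'"
      by (rule *) (simp add: br vw br_def[symmetric])
    show "pgl_apply (abs_pgl2 A) b = b'"
      by (rule *) (simp add: br vw br_def[symmetric])
    show "pgl_apply (abs_pgl2 A) c = c'"
      by (rule *) (use assms in \<open>simp only: br vw br_def[symmetric] ab, simp add: br_swap[of c' b']\<close>)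
  qed
qed

text \<open>Comparing the two matrices on the standard basis and on the sum of the basis vectors shows that
the columns are multiplied by the same factor.\<close>

lemma pgl_eqI:
  assumes "\<And>p. pgl_apply A p = pgl_apply B p"
  shows "A = B"
proof -
  obtain A' where A: "invertible A'" "A = abs_pgl2 A'" by (rule pgl_cases)
  obtain B' where B: "invertible B'" "B = abs_pgl2 B'" by (rule pgl_cases)
  have *: "\<exists>k. k \<noteq> 0 \<and> B' *v x = k *s (A' *v x)" if "x \<noteq> 0" for x
    using assms[of "abs_proj_line x"] that A B abs_proj_line_eq_iff[of "A' *v x" "B' *v x"]
    by (simp add: pgl_apply_abs invertible_mult_nonzero)
  define e1 e2 :: "'a^2" where e: "e1 = (\<chi> i. if i = 1 then 1 else 0)"
    "e2 = (\<chi> i. if i = 1 then 0 else 1)"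
  have "e1 \<noteq> 0" "e2 \<noteq> 0" "e1 + e2 \<noteq> 0" by (auto simp: e vec_eq_iff forall_2)
  then obtain k l m where k: "k \<noteq> 0" "B' *v e1 = k *s (A' *v e1)"
    and l: "B' *v e2 = l *s (A' *v e2)" and m: "B' *v (e1 + e2) = m *s (A' *v (e1 + e2))"
    using * by metis
  have 1: "B' $ 1 $ 1 = k * A' $ 1 $ 1" "B' $ 2 $ 1 = k * A' $ 2 $ 1"
    and 2: "B' $ 1 $ 2 = l * A' $ 1 $ 2" "B' $ 2 $ 2 = l * A' $ 2 $ 2"
    and 3: "B' $ 1 $ 1 + B' $ 1 $ 2 = m * (A' $ 1 $ 1 + A' $ 1 $ 2)"
      "B' $ 2 $ 1 + B' $ 2 $ 2 = m * (A' $ 2 $ 1 + A' $ 2 $ 2)"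
    using k(2) l m by (auto simp: e matrix_vector_mult_def vec_eq_iff sum_2 forall_2)
  have det: "A' $ 1 $ 1 * A' $ 2 $ 2 - A' $ 1 $ 2 * A' $ 2 $ 1 \<noteq> 0"
    using A(1) by (simp add: invertible_det_nz det_2)
  have "(k - m) * (A' $ 1 $ 1 * A' $ 2 $ 2 - A' $ 1 $ 2 * A' $ 2 $ 1) = 0"
    "(l - m) * (A' $ 1 $ 1 * A' $ 2 $ 2 - A' $ 1 $ 2 * A' $ 2 $ 1) = 0"
    using 3 unfolding 1 2 by algebra+
  with det have "l = k" by simp
  then have "B' = mat k ** A'"
    using 1 2 by (simp add: vec_eq_iff forall_2 mat_mult_entry)
  with A B k(1) abs_pgl2_eqI show ?thesis by blast
qed

text \<open>A fourth point is determined by its cross-ratio with the three given ones, so the two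
transformations agree everywhere.\<close>

lemma pgl_eqI_three:
  assumes "a \<noteq> b" "a \<noteq> c" "b \<noteq> c"
    and "pgl_apply A a = pgl_apply B a" "pgl_apply A b = pgl_apply B b" "pgl_apply A c = pgl_apply B c"
  shows "A = B"
proof (rule pgl_eqI)
  fix d
  show "pgl_apply A d = pgl_apply B d"
  proof (cases "d = a \<or> d = b")
    case True
    then show ?thesis using assms by auto
  next
    case False
    have "cross_ratio (pgl_apply A a) (pgl_apply A b) (pgl_apply A c) (pgl_apply A d)
        = cross_ratio (pgl_apply B a) (pgl_apply B b) (pgl_apply B c) (pgl_apply B d)"
      by (simp only: cross_ratio_pgl_apply)
    moreover have "pgl_apply A d \<noteq> pgl_apply A a" "pgl_apply A d \<noteq> pgl_apply A b"
      "pgl_apply B d \<noteq> pgl_apply B a" "pgl_apply B d \<noteq> pgl_apply B b"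
      using False by simp_all
    moreover have "pgl_apply A a \<noteq> pgl_apply A b" "pgl_apply A a \<noteq> pgl_apply A c"
      "pgl_apply A b \<noteq> pgl_apply A c"
      using assms(1-3) by simp_all
    ultimately show ?thesis
      using cross_ratio_inject unfolding assms(4-6) by metis
  qed
qed

section \<open>Twisted polygons and their cross-ratio coordinates\<close>

text \<open>The condition on three consecutive vertices, as a condition on pairs at distance one and two.\<close>

definition regular :: "(int \<Rightarrow> 'a proj_line) \<Rightarrow> bool" where
  "regular p \<longleftrightarrow> (\<forall>i. p i \<noteq> p (i + 1) \<and> p i \<noteq> p (i + 2))"

lemma ngons_iff:
  "(p, M) \<in> ngons n \<longleftrightarrow> regular p \<and> (\<forall>i. p (i + int n) = pgl_apply M (p i))"
proof -
  have "p (i + 1) \<noteq> p (i + 2)" if "\<forall>i. p i \<noteq> p (i + 1)" for i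
    using spec[OF that, of "i + 1"] by (simp add: add.assoc)
  then show ?thesis unfolding ngons_def regular_def by blast
qed

text \<open>These equations bring shifted indices into the form in which \<open>regular\<close> and \<open>polygon_cr\<close> use them;
arithmetic normalisation would reorder the summands instead.\<close>

lemma int_shift:
  fixes i :: int shows "i - 1 + 1 = i" "i - 1 + 2 = i + 1" "i + 1 + 1 = i + 2" "i + 1 - 1 = i"
  by simp_all

lemma regularD:
  assumes "regular p" shows "p i \<noteq> p (i + 1)" "p i \<noteq> p (i + 2)" "p (i - 1) \<noteq> p i"
    "p (i - 1) \<noteq> p (i + 1)" "p (i + 1) \<noteq> p (i + 2)"
  using assms[unfolded regular_def, rule_format, of i]
    assms[unfolded regular_def, rule_format, of "i - 1"]
    assms[unfolded regular_def, rule_format, of "i + 1"] unfolding int_shift by simp_all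

lemma polygon_cr_nonzero: "regular p \<Longrightarrow> polygon_cr (p, M) i \<noteq> 0"
  using regularD[of p i] by (auto simp: polygon_cr_def cross_ratio_br)

lemma polygon_cr_in_curvatures:
  assumes "P \<in> ngons n" shows "polygon_cr P \<in> curvatures n"
proof -
  obtain p M where P: "P = (p, M)" by (cases P)
  with assms have *: "regular p" "p (i + int n) = pgl_apply M (p i)" for i
    by (auto simp: ngons_iff)
  have "polygon_cr P (i + int n) = polygon_cr P i" for i
  proof -
    have "p (i + int n + 1) = pgl_apply M (p (i + 1))" "p (i + int n - 1) = pgl_apply M (p (i - 1))"
      "p (i + int n + 2) = pgl_apply M (p (i + 2))"
      using *(2)[of "i + 1"] *(2)[of "i - 1"] *(2)[of "i + 2"] by (simp_all add: algebra_simps)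
    then show ?thesis by (simp add: P polygon_cr_def *(2))
  qed
  then show ?thesis using *(1) by (simp add: curvatures_def P polygon_cr_nonzero)
qed

text \<open>Three consecutive vertices and a coordinate determine the next vertex, and also the previous one;
the two directions are related by the symmetry of the cross-ratio.\<close>

lemma regular_rigid:
  assumes p: "regular p" and q: "regular q" and cr: "polygon_cr (p, M) = polygon_cr (q, N)"
    and init: "pgl_apply A (p 0) = q 0" "pgl_apply A (p 1) = q 1" "pgl_apply A (p 2) = q 2"
  shows "pgl_apply A (p i) = q i"
proof -
  let ?T = "\<lambda>i. pgl_apply A (p i) = q i \<and> pgl_apply A (p (i + 1)) = q (i + 1)
    \<and> pgl_apply A (p (i + 2)) = q (i + 2)"
  have cr': "cross_ratio (pgl_apply A (p i)) (pgl_apply A (p (i + 1)))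
      (pgl_apply A (p (i - 1))) (pgl_apply A (p (i + 2)))
    = cross_ratio (q i) (q (i + 1)) (q (i - 1)) (q (i + 2))" for i
    using fun_cong[OF cr, of i] by (simp add: polygon_cr_def)
  have "?T i"
  proof (induction i rule: int_induct[where k = 0])
    case base
    with init show ?case by simp
  next
    case (step1 i)
    let ?j = "i + 1"
    have T: "pgl_apply A (p (?j - 1)) = q (?j - 1)" "pgl_apply A (p ?j) = q ?j"
      "pgl_apply A (p (?j + 1)) = q (?j + 1)"
      using step1 by (simp_all add: add.assoc)
    have "pgl_apply A (p (?j + 2)) = q (?j + 2)"
    proof (rule cross_ratio_inject)
      show "cross_ratio (q ?j) (q (?j + 1)) (q (?j - 1)) (pgl_apply A (p (?j + 2)))
        = cross_ratio (q ?j) (q (?j + 1)) (q (?j - 1)) (q (?j + 2))"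
        using cr'[of ?j] unfolding T .
      show "pgl_apply A (p (?j + 2)) \<noteq> q ?j" "pgl_apply A (p (?j + 2)) \<noteq> q (?j + 1)"
        unfolding T[symmetric] pgl_apply_eq_iff using regularD[OF p, of ?j] by simp_all
    qed (use regularD[OF q, of ?j] in simp_all)
    with T show ?case by blast
  next
    case (step2 i)
    have "pgl_apply A (p (i - 1)) = q (i - 1)"
    proof (rule cross_ratio_inject)
      show "cross_ratio (q (i + 1)) (q i) (q (i + 2)) (pgl_apply A (p (i - 1)))
        = cross_ratio (q (i + 1)) (q i) (q (i + 2)) (q (i - 1))"
        using cr'[of i] step2(2) by (simp add: cross_ratio_swap)
      have T: "q i = pgl_apply A (p i)" "q (i + 1) = pgl_apply A (p (i + 1))"
        using step2(2) by simp_all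
      show "pgl_apply A (p (i - 1)) \<noteq> q (i + 1)" "pgl_apply A (p (i - 1)) \<noteq> q i"
        unfolding T pgl_apply_eq_iff using regularD[OF p, of i] by simp_all
    qed (use regularD[OF q, of i] in \<open>simp_all add: eq_commute\<close>)
    with step2(2) show ?case unfolding int_shift by blast
  qed
  then show ?thesis ..
qed

lemma pgl_act_ngons:
  assumes "P \<in> ngons n"
  shows "pgl_act A P \<in> ngons n" "polygon_cr (pgl_act A P) = polygon_cr P"
proof -
  obtain p M where P: "P = (p, M)" by (cases P)
  show "pgl_act A P \<in> ngons n"
    using assms
    by (simp add: P pgl_act_def ngons_iff regular_def pgl_apply_mult pgl_apply_inv)
  show "polygon_cr (pgl_act A P) = polygon_cr P"
    by (rule ext) (simp add: P pgl_act_def polygon_cr_def)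
qed

text \<open>Rigidity yields a transformation of the vertices.  It also matches the monodromies, as these are
determined by their effect on three vertices.\<close>

lemma pgl_related_iff:
  assumes "P \<in> ngons n" "Q \<in> ngons n"
  shows "(\<exists>A. Q = pgl_act A P) \<longleftrightarrow> polygon_cr Q = polygon_cr P"
proof
  assume "\<exists>A. Q = pgl_act A P"
  with assms show "polygon_cr Q = polygon_cr P" using pgl_act_ngons by blast
next
  assume cr: "polygon_cr Q = polygon_cr P"
  obtain p M where P: "P = (p, M)" by (cases P)
  obtain q N where Q: "Q = (q, N)" by (cases Q)
  have p: "regular p" "p (i + int n) = pgl_apply M (p i)" for i
    using assms by (auto simp: P ngons_iff)
  have q: "regular q" "q (i + int n) = pgl_apply N (q i)" for i
    using assms by (auto simp: Q ngons_iff)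
  obtain A where "pgl_apply A (p 0) = q 0" "pgl_apply A (p 1) = q 1" "pgl_apply A (p 2) = q 2"
    using pgl_three_transitive[of "p 0" "p 1" "p 2" "q 0" "q 1" "q 2"]
      regularD[OF p(1), of 0] regularD[OF q(1), of 0] by auto
  then have A: "pgl_apply A (p i) = q i" for i
    using regular_rigid[OF p(1) q(1)] cr P Q by metis
  let ?B = "pgl_mult (pgl_mult A M) (pgl_inv A)"
  have N: "pgl_apply N (q i) = pgl_apply ?B (q i)" for i
  proof -
    have "pgl_apply N (q i) = pgl_apply A (p (i + int n))"
      by (simp only: A q(2))
    also have "\<dots> = pgl_apply ?B (pgl_apply A (p i))"
      by (simp add: p(2) pgl_apply_mult pgl_apply_inv)
    finally show ?thesis by (simp only: A)
  qed
  have "N = ?B"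
    using pgl_eqI_three[of "q 0" "q 1" "q 2" N ?B] regularD[OF q(1), of 0] N by simp
  then have "Q = pgl_act A P" using A by (simp add: P Q pgl_act_def)
  then show "\<exists>A. Q = pgl_act A P" ..
qed

text \<open>Two one-sided recursions, one forwards and one backwards from the index \<open>0\<close>, glued at their common
starting value.\<close>

lemma bidirectional_choice:
  fixes R :: "int \<Rightarrow> 'b \<Rightarrow> 'b \<Rightarrow> bool"
  assumes x: "P x"
    and fwd: "\<And>i x. P x \<Longrightarrow> \<exists>y. P y \<and> R i x y"
    and bwd: "\<And>i y. P y \<Longrightarrow> \<exists>x. P x \<and> R i x y"
  obtains s where "\<And>i. P (s i)" "\<And>i. R i (s i) (s (i + 1))"
proof -
  define f where "f i x = (SOME y. P y \<and> R i x y)" for i x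
  define g where "g i y = (SOME x. P x \<and> R i x y)" for i y
  have f: "P (f i x) \<and> R i x (f i x)" if "P x" for i x
    unfolding f_def using someI_ex[OF fwd[OF that]] .
  have g: "P (g i y) \<and> R i (g i y) y" if "P y" for i y
    unfolding g_def using someI_ex[OF bwd[OF that]] .
  define F where "F = rec_nat x (\<lambda>k. f (int k))"
  define G where "G = rec_nat x (\<lambda>k. g (- int k - 1))"
  have F: "F 0 = x" "F (Suc k) = f (int k) (F k)" and G: "G 0 = x" "G (Suc k) = g (- int k - 1) (G k)" for k
    by (simp_all add: F_def G_def)
  have PF: "P (F k)" and PG: "P (G k)" for k
    by (induction k) (use x f g in \<open>auto simp: F G\<close>)
  define s where "s i = (if i \<ge> 0 then F (nat i) else G (nat (- i)))" for i
  show thesis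
  proof (rule that[of s])
    show "P (s i)" for i by (simp add: s_def PF PG)
    show "R i (s i) (s (i + 1))" for i
    proof (cases "i \<ge> 0")
      case True
      then have "nat (i + 1) = Suc (nat i)" by simp
      with True f[OF PF, of i "nat i"] show ?thesis by (simp add: s_def F)
    next
      case False
      then obtain k where k: "i = - int k - 1" by (metis add.commute int_ops(4) minus_add_distrib
            negD not_le uminus_add_conv_diff)
      have "s i = G (Suc k)" "s (i + 1) = G k"
        by (auto simp: k s_def nat_add_distrib F G)
      with g[OF PG, of i k] show ?thesis by (simp add: G k)
    qed
  qed
qed

lemma three_points:
  obtains a b c :: "'a::field proj_line" where "a \<noteq> b" "a \<noteq> c" "b \<noteq> c"
proof -
  define v where "v x y = ((\<chi> i. if i = 1 then x else y) :: 'a^2)" for x y :: 'a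
  have v: "v x y \<noteq> 0 \<longleftrightarrow> x \<noteq> 0 \<or> y \<noteq> 0" "bracket (v x y) (v z w) = x * w - z * y" for x y z w
    by (auto simp: v_def vec_eq_iff forall_2 bracket_def)
  have ne: "abs_proj_line (v x y) \<noteq> abs_proj_line (v z w)"
    if "x \<noteq> 0 \<or> y \<noteq> 0" "z \<noteq> 0 \<or> w \<noteq> 0" "x * w - z * y \<noteq> 0" for x y z w
    using that abs_proj_line_eq_iff[of "v x y" "v z w"] bracket_eq_0_iff[of "v x y" "v z w"] v by simp
  show thesis
    by (rule that[of "abs_proj_line (v 1 0)" "abs_proj_line (v 0 1)" "abs_proj_line (v 1 1)"])
      (rule ne; simp)+
qed

text \<open>The recursion runs over triples of consecutive vertices: such a triple and the next coordinate
determine the next triple, and conversely.\<close>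

lemma regular_with_cross_ratios:
  fixes c :: "int \<Rightarrow> 'a::field"
  assumes c: "\<And>i. c i \<noteq> 0"
  obtains p where "regular p" "\<forall>M. polygon_cr (p, M) = c"
proof -
  let ?P = "\<lambda>(a :: 'a proj_line, b, d). a \<noteq> b \<and> a \<noteq> d \<and> b \<noteq> d"
  let ?R = "\<lambda>i (a :: 'a proj_line, b, d) (a', b', d'). a' = b \<and> b' = d \<and> cross_ratio b d a d' = c (i + 1)"
  obtain x y z :: "'a proj_line" where xyz: "?P (x, y, z)" by (rule three_points) auto
  obtain s where s: "?P (s i)" "?R i (s i) (s (i + 1))" for i
  proof (rule bidirectional_choice[of ?P "(x, y, z)" ?R])
    show "?P (x, y, z)" by (fact xyz)
    fix i and t :: "'a proj_line \<times> 'a proj_line \<times> 'a proj_line"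
    assume t: "?P t"
    obtain a b d where abd: "t = (a, b, d)" by (cases t)
    obtain e where e: "e \<noteq> b" "e \<noteq> d" "cross_ratio b d a e = c (i + 1)"
      using cross_ratio_surj[of b d a "c (i + 1)"] t c[of "i + 1"] abd by auto
    then show "\<exists>y. ?P y \<and> ?R i t y"
      using t abd by (intro exI[of _ "(b, d, e)"]) auto
    obtain e where e: "e \<noteq> b" "e \<noteq> a" "cross_ratio b a d e = c (i + 1)"
      using cross_ratio_surj[of b a d "c (i + 1)"] t c[of "i + 1"] abd by auto
    then show "\<exists>y. ?P y \<and> ?R i y t"
      using t abd cross_ratio_swap[of b a d e] by (intro exI[of _ "(e, a, b)"]) auto
  qed blast
  define p where "p i = fst (s i)" for i
  have R: "s (i + 1) = (fst (snd (s i)), snd (snd (s i)), snd (snd (s (i + 1))))"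
    "cross_ratio (fst (snd (s i))) (snd (snd (s i))) (fst (s i)) (snd (snd (s (i + 1)))) = c (i + 1)" for i
    using s(2)[of i] by (auto simp: case_prod_unfold intro!: prod_eqI)
  have p1: "p (i + 1) = fst (snd (s i))" for i
    using arg_cong[OF R(1)[of i], of fst] by (simp add: p_def)
  have p2: "p (i + 2) = snd (snd (s i))" for i
    using arg_cong[OF R(1)[of i], of "\<lambda>x. fst (snd x)"] p1[of "i + 1"] by (simp add: add.assoc)
  have "regular p"
    unfolding regular_def p1 p2 using s(1) by (auto simp: p_def case_prod_unfold)
  moreover have "polygon_cr (p, M) = c" for M
  proof
    fix i
    show "polygon_cr (p, M) i = c i"
      using R(2)[of "i - 1"] p1[of "i - 1"] p2[of "i - 1"] p2[of i]
      unfolding polygon_cr_def p_def[of "i - 1", symmetric] int_shift by simp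
  qed
  ultimately show thesis using that by blast
qed

text \<open>The monodromy is obtained by rigidity from the sequence of vertices and its shift by \<open>n\<close>, which
have the same coordinates when these are \<open>n\<close>-periodic.\<close>

lemma ngon_with_cross_ratios:
  assumes "c \<in> curvatures n"
  obtains P where "P \<in> ngons n" "polygon_cr P = c"
proof -
  have c: "c i \<noteq> 0" "c (i + int n) = c i" for i using assms by (auto simp: curvatures_def)
  obtain p where p: "regular p" "\<forall>M. polygon_cr (p, M) = c"
    by (rule regular_with_cross_ratios[of c, OF c(1)])
  define q where "q i = p (i + int n)" for i
  have q: "regular q"
    unfolding regular_def
  proof
    fix i
    show "q i \<noteq> q (i + 1) \<and> q i \<noteq> q (i + 2)"
      using p(1)[unfolded regular_def, rule_format, of "i + int n"] by (simp add: q_def add_ac)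
  qed
  have "polygon_cr (q, M) i = polygon_cr (p, M) (i + int n)" for M i
    by (simp add: polygon_cr_def q_def algebra_simps)
  then have "polygon_cr (p, M) = polygon_cr (q, M)" for M
    by (simp only: fun_eq_iff p(2)[rule_format] c(2) simp_thms)
  moreover obtain M where "pgl_apply M (p 0) = q 0" "pgl_apply M (p 1) = q 1" "pgl_apply M (p 2) = q 2"
    using pgl_three_transitive[of "p 0" "p 1" "p 2" "q 0" "q 1" "q 2"]
      regularD[OF p(1), of 0] regularD[OF q(1), of 0] by auto
  ultimately have "pgl_apply M (p i) = q i" for i
    using regular_rigid[OF p(1) q] by blast
  then have "(p, M) \<in> ngons n" using p(1) by (simp add: ngons_iff q_def)
  with p(2) that show thesis by blast
qed

text \<open>For \<open>n\<close>-periodic nowhere vanishing \<open>c\<close>, a single \<open>PGL\<^sub>2\<close>-orbit, that is, the point of the moduli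
space with coordinates \<open>c\<close>.\<close>

definition fibre :: "nat \<Rightarrow> (int \<Rightarrow> 'a::field) \<Rightarrow> 'a polygon set" where
  "fibre n c = {P \<in> ngons n. polygon_cr P = c}"

lemma polygon_moduli_eq: "polygon_moduli n = fibre n ` curvatures n"
proof -
  have "{(P, Q). P \<in> ngons n \<and> Q \<in> ngons n \<and> (\<exists>A. Q = pgl_act A P)} `` {P}
      = fibre n (polygon_cr P)" if "P \<in> ngons n" for P :: "'a polygon"
    using that pgl_related_iff[OF that] by (auto simp: fibre_def)
  then have "polygon_moduli n = (\<lambda>P :: 'a polygon. fibre n (polygon_cr P)) ` ngons n"
    unfolding polygon_moduli_def quotient_def by auto
  also have "\<dots> = fibre n ` polygon_cr ` ngons n"
    by (simp only: image_image)
  also have "polygon_cr ` ngons n = (curvatures n :: (int \<Rightarrow> 'a) set)"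
  proof (intro equalityI subsetI)
    fix c :: "int \<Rightarrow> 'a" assume "c \<in> curvatures n"
    then show "c \<in> polygon_cr ` ngons n" by (rule ngon_with_cross_ratios) auto
  qed (auto simp: polygon_cr_in_curvatures)
  finally show ?thesis .
qed

lemma class_cr_fibre: "c \<in> curvatures n \<Longrightarrow> class_cr (fibre n c) = c"
proof
  fix i
  assume "c \<in> curvatures n"
  then obtain P where "P \<in> ngons n" "polygon_cr P = c" by (rule ngon_with_cross_ratios)
  then have "(\<lambda>P. polygon_cr P i) ` fibre n c = {c i}" by (auto simp: fibre_def)
  then show "class_cr (fibre n c) i = c i" by (simp add: class_cr_def)
qed

text \<open>The range of the coordinates \<open>(c, \<mu>)\<close> on the enriched moduli space; \<open>point\<close> is the inverse of the
coordinate map.\<close>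

definition torus :: "nat \<Rightarrow> ((int \<Rightarrow> 'a::field) \<times> (int \<Rightarrow> 'a)) set" where
  "torus n = curvatures n \<times> curvatures n"

definition point :: "nat \<Rightarrow> (int \<Rightarrow> 'a::field) \<times> (int \<Rightarrow> 'a) \<Rightarrow> 'a enriched" where
  "point n = map_prod (fibre n) id"

lemma enriched_moduli_eq: "enriched_moduli n = point n ` torus n"
  unfolding enriched_moduli_def point_def torus_def polygon_moduli_eq
  by (simp add: map_prod_surj_on)

section \<open>Flips in coordinates\<close>

text \<open>A point with non-zero cross-ratio \<open>q\<close> is different from \<open>b\<close> and \<open>d\<close>, so that the Pluecker relation
gives uniqueness even though the cross-ratio takes a default value at these points.\<close>

lemma h_map_eqI:
  assumes "a \<noteq> b" "a \<noteq> d" "b \<noteq> d" "q \<noteq> 0" and c: "cross_ratio a c b d = q"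
  shows "h_map q b d a = c"
proof -
  have "c' = c" if c': "cross_ratio a c' b d = q" for c'
  proof -
    have nz: "br x b \<noteq> 0" "br x d \<noteq> 0" if "cross_ratio a x b d = q" for x
      using that \<open>q \<noteq> 0\<close> by (auto simp: cross_ratio_br)
    have "br a b / br a d * (br c' d / br c' b) = br a b / br a d * (br c d / br c b)"
      using c c' unfolding cross_ratio_br by simp
    then have "br c d * br c' b = br c' d * br c b"
      using assms(1,2) nz[OF c] nz[OF c'] by (simp add: field_simps)
    then have "br c c' * br d b = 0"
      using br_pluecker[of c c' d b] by (simp add: mult.commute)
    with \<open>b \<noteq> d\<close> show ?thesis by auto
  qed
  then have "(THE c. cross_ratio a c b d = q) = c" using c by blast
  with assms show ?thesis by (simp add: h_map_def)
qed

text \<open>If a representative of \<open>a\<close> is written as a combination of representatives of \<open>b\<close> and \<open>d\<close>, then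
the transformation multiplies the component along \<open>b\<close> by \<open>q\<close>; its coefficients are brackets with
\<open>a\<close>.\<close>

lemma h_map_point:
  assumes "a \<noteq> b" "a \<noteq> d" "b \<noteq> d" "q \<noteq> 0"
  obtains k where "k \<noteq> 0" "\<forall>e. br (h_map q b d a) e = k * (q * br a d * br b e + br b a * br d e)"
proof -
  obtain c k where k: "k \<noteq> 0" and c: "\<And>e. br c e = k * (q * br a d * br b e + br b a * br d e)"
    by (rule combination_point[OF \<open>b \<noteq> d\<close>, of "q * br a d" "br b a"]) (use assms in auto)
  have "br c d = k * q * br a d * br b d" "br c b = k * br a b * br b d"
    using c[of d] c[of b] by (simp_all add: br_swap[of b a] br_swap[of d b])
  then have "cross_ratio a c b d = q"
    unfolding cross_ratio_br using k assms by (simp add: field_simps)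
  then have "h_map q b d a = c" by (rule h_map_eqI[OF assms])
  with that[OF k] c show thesis by simp
qed

lemma cross_ratio_h_map:
  assumes "a \<noteq> b" "a \<noteq> d" "b \<noteq> d" "q \<noteq> 0"
  shows "cross_ratio a (h_map q b d a) b d = q"
proof -
  obtain k where k: "k \<noteq> 0"
    and "\<forall>e. br (h_map q b d a) e = k * (q * br a d * br b e + br b a * br d e)"
    by (rule h_map_point[OF assms])
  then have h: "br (h_map q b d a) e = k * (q * br a d * br b e + br b a * br d e)" for e
    by blast
  show ?thesis
    unfolding cross_ratio_br h using k assms
    by (simp add: br_swap[of b a] br_swap[of d b] field_simps)
qed

lemma h_map_pgl_apply:
  assumes "a \<noteq> b" "a \<noteq> d" "b \<noteq> d" "q \<noteq> 0"
  shows "h_map q (pgl_apply A b) (pgl_apply A d) (pgl_apply A a) = pgl_apply A (h_map q b d a)"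
  by (rule h_map_eqI) (use assms in \<open>simp_all add: cross_ratio_h_map\<close>)

text \<open>With \<open>b = p\<^bsub>i+1\<^esub>\<close>, \<open>d = p\<^bsub>i-1\<^esub>\<close> and \<open>a = p\<^sub>i\<close>, the two cross-ratios are the coordinates \<open>c\<^sub>i\<close> (for
\<open>e = p\<^bsub>i+2\<^esub>\<close>) and \<open>c\<^bsub>i-1\<^esub>\<close> (for \<open>e = p\<^bsub>i-2\<^esub>\<close>).  The two formulas for the bracket with \<open>e\<close> arise by
using the Pluecker relation to eliminate one or the other summand of the combination.\<close>

lemma h_map_brackets:
  assumes "a \<noteq> b" "a \<noteq> d" "b \<noteq> d" "q \<noteq> 0"
  shows "\<exists>m. m \<noteq> 0 \<and> br (h_map q b d a) b = m * br a b \<and> br (h_map q b d a) d = m * q * br a d \<and>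
    (\<forall>e. e \<noteq> a \<longrightarrow>
      br (h_map q b d a) e = m * (1 + (q - 1) * cross_ratio a b d e) * br a e \<and>
      br (h_map q b d a) e = m * (q + (1 - q) * cross_ratio d a e b) * br a e)"
proof -
  obtain k where k: "k \<noteq> 0"
    and "\<forall>e. br (h_map q b d a) e = k * (q * br a d * br b e + br b a * br d e)"
    by (rule h_map_point[OF assms])
  then have h: "br (h_map q b d a) e = k * (q * br a d * br b e + br b a * br d e)" for e
    by blast
  show ?thesis
  proof (intro exI[of _ "k * br b d"] conjI allI impI)
    show "k * br b d \<noteq> 0" using k assms by simp
    show "br (h_map q b d a) b = k * br b d * br a b" "br (h_map q b d a) d = k * br b d * q * br a d"
      unfolding h by (simp_all add: br_swap[of b a] br_swap[of d b])
    fix e assume "e \<noteq> a"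
    then have nz: "br a e \<noteq> 0" "br b d \<noteq> 0" using assms by auto
    have pl: "br d e * br a b = br a d * br b e - br a e * br b d"
      using br_pluecker[of a b d e] by (simp add: mult.commute)
    have "(1 + (q - 1) * cross_ratio a b d e) * br a e * br b d
        = br a e * br b d + (q - 1) * (br a d * br b e)"
      unfolding cross_ratio_br using nz by (simp add: field_simps)
    also have "\<dots> = q * br a d * br b e - br d e * br a b"
      unfolding pl by (simp add: algebra_simps)
    finally show "br (h_map q b d a) e = k * br b d * (1 + (q - 1) * cross_ratio a b d e) * br a e"
      unfolding h by (simp add: br_swap[of b a] mult_ac)
    have "(q + (1 - q) * cross_ratio d a e b) * br a e * br b d
        = q * (br a e * br b d) - (1 - q) * (br d e * br a b)"
      unfolding cross_ratio_br br_swap[of d b] using nz by (simp add: field_simps)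
    also have "\<dots> = q * br a d * br b e - br d e * br a b"
      unfolding pl by (simp add: algebra_simps)
    finally show "br (h_map q b d a) e = k * br b d * (q + (1 - q) * cross_ratio d a e b) * br a e"
      unfolding h by (simp add: br_swap[of b a] mult_ac)
  qed
qed

definition flip_seq ::
    "int set \<Rightarrow> (int \<Rightarrow> 'a::field) \<Rightarrow> (int \<Rightarrow> 'a proj_line) \<Rightarrow> (int \<Rightarrow> 'a proj_line)" where
  "flip_seq S q p i = (if i \<in> S then h_map (q i) (p (i + 1)) (p (i - 1)) (p i) else p i)"

text \<open>Indices which may be flipped simultaneously without interaction: no bracket of vertices at
distance at most two contains two of them.\<close>

definition sparse :: "int set \<Rightarrow> bool" where
  "sparse S \<longleftrightarrow> (\<forall>i\<in>S. i + 1 \<notin> S \<and> i + 2 \<notin> S)"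

text \<open>The factor that a flip at the indices in \<open>S\<close> contributes at \<open>i\<close>.  Writing the change of all
coordinates as one product of such factors avoids a case distinction on the position of \<open>i\<close>
relative to \<open>S\<close>, and treats coincidences for \<open>n = 3\<close> uniformly.\<close>

definition on_set :: "int set \<Rightarrow> (int \<Rightarrow> 'a::one) \<Rightarrow> int \<Rightarrow> 'a" where
  "on_set S f i = (if i \<in> S then f i else 1)"

text \<open>The factors by which a flip at \<open>i\<close> multiplies the brackets with the vertices at \<open>i + 2\<close> and at
\<open>i - 2\<close>, respectively.\<close>

definition right_factor :: "(int \<Rightarrow> 'a::field) \<Rightarrow> (int \<Rightarrow> 'a) \<Rightarrow> int \<Rightarrow> 'a" where
  "right_factor q c i = 1 + (q i - 1) * c i"

definition left_factor :: "(int \<Rightarrow> 'a::field) \<Rightarrow> (int \<Rightarrow> 'a) \<Rightarrow> int \<Rightarrow> 'a" where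
  "left_factor q c i = q i + (1 - q i) * c (i - 1)"

definition flip_cr :: "int set \<Rightarrow> (int \<Rightarrow> 'a::field) \<Rightarrow> (int \<Rightarrow> 'a) \<Rightarrow> int \<Rightarrow> 'a" where
  "flip_cr S q c i = c i * on_set S q i * on_set S q (i + 2) /
     (on_set S (right_factor q c) i * on_set S (right_factor q c) (i - 1) *
      on_set S (left_factor q c) (i + 1) * on_set S (left_factor q c) (i + 2))"

text \<open>The factors \<open>m\<close> account for the choice of representatives.  In each coordinate they cancel, as
each of the four vertices occurs once in the numerator and once in the denominator.\<close>

lemma flip_seq_brackets:
  fixes p :: "int \<Rightarrow> 'a::field proj_line" and q :: "int \<Rightarrow> 'a"
  assumes p: "regular p" and q: "\<And>i. q i \<noteq> 0" and S: "sparse S"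
  shows "\<exists>m. \<forall>i. m i \<noteq> 0 \<and>
    br (flip_seq S q p i) (flip_seq S q p (i + 1))
      = m i * m (i + 1) * on_set S q (i + 1) * br (p i) (p (i + 1)) \<and>
    br (flip_seq S q p i) (flip_seq S q p (i + 2))
      = m i * m (i + 2) * on_set S (right_factor q (polygon_cr (p, M))) i
         * on_set S (left_factor q (polygon_cr (p, M))) (i + 2) * br (p i) (p (i + 2))"
proof -
  let ?c = "polygon_cr (p, M)"
  let ?h = "\<lambda>i. h_map (q i) (p (i + 1)) (p (i - 1)) (p i)"
  define good where "good i m \<longleftrightarrow> m \<noteq> 0 \<and> br (?h i) (p (i + 1)) = m * br (p i) (p (i + 1))
    \<and> br (?h i) (p (i - 1)) = m * q i * br (p i) (p (i - 1))
    \<and> br (?h i) (p (i + 2)) = m * right_factor q ?c i * br (p i) (p (i + 2))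
    \<and> br (?h i) (p (i - 2)) = m * left_factor q ?c i * br (p i) (p (i - 2))" for i m
  have "\<exists>m. good i m" for i
  proof -
    have "p (i + 2) \<noteq> p i" "p (i - 2) \<noteq> p i"
      using regularD(2)[OF p, of i] regularD(2)[OF p, of "i - 2"] by auto
    moreover have "p i \<noteq> p (i + 1)" "p i \<noteq> p (i - 1)" "p (i + 1) \<noteq> p (i - 1)"
      using regularD[OF p, of i] by auto
    ultimately obtain m where m: "m \<noteq> 0" "br (?h i) (p (i + 1)) = m * br (p i) (p (i + 1))"
      "br (?h i) (p (i - 1)) = m * q i * br (p i) (p (i - 1))"
      "br (?h i) (p (i + 2)) = m * (1 + (q i - 1)
         * cross_ratio (p i) (p (i + 1)) (p (i - 1)) (p (i + 2))) * br (p i) (p (i + 2))"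
      "br (?h i) (p (i - 2)) = m * (q i + (1 - q i)
         * cross_ratio (p (i - 1)) (p i) (p (i - 2)) (p (i + 1))) * br (p i) (p (i - 2))"
      using h_map_brackets[of "p i" "p (i + 1)" "p (i - 1)" "q i"] q[of i] by blast
    have "?c (i - 1) = cross_ratio (p (i - 1)) (p i) (p (i - 2)) (p (i + 1))"
      by (simp add: polygon_cr_def algebra_simps)
    with m have "good i m"
      unfolding good_def right_factor_def left_factor_def by (simp add: polygon_cr_def)
    then show ?thesis by blast
  qed
  then obtain m where "good i (m i)" for i by metis
  then have m: "m i \<noteq> 0" "br (?h i) (p (i + 1)) = m i * br (p i) (p (i + 1))"
    "br (?h i) (p (i - 1)) = m i * q i * br (p i) (p (i - 1))"
    "br (?h i) (p (i + 2)) = m i * right_factor q ?c i * br (p i) (p (i + 2))"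
    "br (?h i) (p (i - 2)) = m i * left_factor q ?c i * br (p i) (p (i - 2))" for i
    unfolding good_def by blast+
  define m' where "m' = on_set S m"
  show ?thesis
  proof (intro exI[of _ m'] allI conjI)
    show "m' i \<noteq> 0" for i using m(1) by (simp add: m'_def on_set_def)
    show "br (flip_seq S q p i) (flip_seq S q p (i + 1))
       = m' i * m' (i + 1) * on_set S q (i + 1) * br (p i) (p (i + 1))" for i
      using S m(2)[of i] m(3)[of "i + 1"]
        br_swap[of "p (i + 1)" "p i"] br_swap[of "?h (i + 1)" "p i"]
      unfolding sparse_def flip_seq_def on_set_def m'_def by auto
    have "i + 2 \<notin> S" if "i \<in> S" for i using S that unfolding sparse_def by blast
    then show "br (flip_seq S q p i) (flip_seq S q p (i + 2))
       = m' i * m' (i + 2) * on_set S (right_factor q ?c) i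
         * on_set S (left_factor q ?c) (i + 2) * br (p i) (p (i + 2))" for i
      using m(4)[of i] m(5)[of "i + 2"]
        br_swap[of "p (i + 2)" "p i"] br_swap[of "?h (i + 2)" "p i"]
      unfolding flip_seq_def on_set_def m'_def by auto
  qed
qed

text \<open>Ordering the vertices in each bracket by their indices makes the signs disappear.\<close>

lemma polygon_cr_br:
  "polygon_cr (p, M) i = br (p (i - 1)) (p i) * br (p (i + 1)) (p (i + 2)) /
     (br (p i) (p (i + 2)) * br (p (i - 1)) (p (i + 1)))"
  unfolding polygon_cr_def cross_ratio_br
  by (simp add: br_swap[of "p i" "p (i - 1)"] br_swap[of "p (i + 1)" "p (i - 1)"])

text \<open>Neighbouring vertices stay distinct in any case; vertices at distance two may collide, and the
factors \<open>u\<close> and \<open>w\<close> detect this.\<close>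

lemma
  fixes p :: "int \<Rightarrow> 'a::field proj_line" and q :: "int \<Rightarrow> 'a"
  assumes "regular p" "\<And>i. q i \<noteq> 0" "sparse S"
  shows flip_seq_regular_iff: "regular (flip_seq S q p) \<longleftrightarrow>
      (\<forall>i\<in>S. right_factor q (polygon_cr (p, M)) i \<noteq> 0 \<and> left_factor q (polygon_cr (p, M)) i \<noteq> 0)"
    and polygon_cr_flip_seq:
      "polygon_cr (flip_seq S q p, N) = flip_cr S q (polygon_cr (p, M))"
proof -
  let ?p = "flip_seq S q p"
  let ?U = "on_set S (right_factor q (polygon_cr (p, M)))"
  let ?W = "on_set S (left_factor q (polygon_cr (p, M)))"
  obtain m where "\<forall>i. m i \<noteq> 0 \<and>
      br (?p i) (?p (i + 1)) = m i * m (i + 1) * on_set S q (i + 1) * br (p i) (p (i + 1)) \<and>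
      br (?p i) (?p (i + 2)) = m i * m (i + 2) * ?U i * ?W (i + 2) * br (p i) (p (i + 2))"
    using flip_seq_brackets[where q = q and M = M, OF assms] by (elim exE)
  then have m: "m i \<noteq> 0"
      "br (?p i) (?p (i + 1)) = m i * m (i + 1) * on_set S q (i + 1) * br (p i) (p (i + 1))"
      "br (?p i) (?p (i + 2)) = m i * m (i + 2) * ?U i * ?W (i + 2) * br (p i) (p (i + 2))" for i
    by blast+
  have "?p i \<noteq> ?p (i + 1)" for i
  proof -
    have "br (?p i) (?p (i + 1)) \<noteq> 0"
      unfolding m(2) using m(1) assms(2) regularD(1)[OF assms(1), of i] by (simp add: on_set_def)
    then show ?thesis by simp
  qed
  moreover have "?p i \<noteq> ?p (i + 2) \<longleftrightarrow> ?U i \<noteq> 0 \<and> ?W (i + 2) \<noteq> 0" for i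
  proof -
    have "br (?p i) (?p (i + 2)) \<noteq> 0 \<longleftrightarrow> ?U i \<noteq> 0 \<and> ?W (i + 2) \<noteq> 0"
      unfolding m(3) using m(1) regularD(2)[OF assms(1), of i] by simp
    then show ?thesis by simp
  qed
  ultimately have "regular ?p \<longleftrightarrow> (\<forall>i. ?U i \<noteq> 0) \<and> (\<forall>i. ?W (i + 2) \<noteq> 0)"
    unfolding regular_def by blast
  also have "(\<forall>i. ?W (i + 2) \<noteq> 0) \<longleftrightarrow> (\<forall>i. ?W i \<noteq> 0)"
    by (metis diff_add_cancel)
  finally show "regular ?p \<longleftrightarrow>
      (\<forall>i\<in>S. right_factor q (polygon_cr (p, M)) i \<noteq> 0 \<and> left_factor q (polygon_cr (p, M)) i \<noteq> 0)"
    by (auto simp: on_set_def)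
  show "polygon_cr (?p, N) = flip_cr S q (polygon_cr (p, M))"
  proof
    fix i
    show "polygon_cr (?p, N) i = flip_cr S q (polygon_cr (p, M)) i"
      using m(2)[of "i - 1"] m(2)[of "i + 1"] m(3)[of i] m(3)[of "i - 1"]
        m(1)[of i] m(1)[of "i + 1"] m(1)[of "i + 2"] m(1)[of "i - 1"]
      unfolding int_shift flip_cr_def polygon_cr_br[of _ _ i] by (simp add: mult_ac)
  qed
qed

definition residue_class :: "nat \<Rightarrow> int \<Rightarrow> int set" where
  "residue_class n j = {i. i mod int n = j mod int n}"

lemma sparse_residue_class:
  assumes "n \<ge> 3" shows "sparse (residue_class n j)"
proof -
  have "(i + k) mod int n \<noteq> i mod int n" if "k \<in> {1, 2}" for i k :: int
  proof
    assume "(i + k) mod int n = i mod int n"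
    then have "int n dvd k" by (simp add: mod_eq_dvd_iff)
    with zdvd_imp_le[of "int n" k] that assms show False by auto
  qed
  then have ne: "(i + 1) mod int n \<noteq> i mod int n" "(i + 2) mod int n \<noteq> i mod int n" for i
    by blast+
  show ?thesis
    unfolding sparse_def
  proof (intro ballI conjI)
    fix i assume "i \<in> residue_class n j"
    then show "i + 1 \<notin> residue_class n j" "i + 2 \<notin> residue_class n j"
      using ne[of i] by (simp_all add: residue_class_def)
  qed
qed

lemma residue_class_periodic: "i + int n \<in> residue_class n j \<longleftrightarrow> i \<in> residue_class n j"
  by (simp add: residue_class_def)

text \<open>The flip of the curvature is a permutation of indices, an involution for sparse \<open>S\<close>.\<close>

definition flip_index :: "int set \<Rightarrow> int \<Rightarrow> int" where
  "flip_index S i = (if i \<in> S then i - 1 else if i + 1 \<in> S then i + 1 else i)"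

lemma flip_curvature_eq: "flip_curvature n j \<mu> i = \<mu> (flip_index (residue_class n j) i)"
  by (simp add: flip_curvature_def flip_index_def residue_class_def)

lemma flip_index_involution:
  assumes "sparse S" shows "flip_index S (flip_index S i) = i"
proof -
  have "i - 1 \<notin> S" if "i \<in> S"
    using assms that unfolding sparse_def by (metis diff_add_cancel)
  then show ?thesis by (simp add: flip_index_def)
qed

lemma flip_curvature_in_curvatures:
  assumes "\<mu> \<in> curvatures n" shows "flip_curvature n j \<mu> \<in> curvatures n"
proof -
  have \<mu>: "\<mu> i \<noteq> 0" "\<mu> (i + int n) = \<mu> i" for i using assms by (auto simp: curvatures_def)
  have "flip_index (residue_class n j) (i + int n) = flip_index (residue_class n j) i + int n" for i
    using residue_class_periodic[of i n j] residue_class_periodic[of "i + 1" n j]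
    by (simp add: flip_index_def algebra_simps)
  with \<mu> show ?thesis by (simp add: curvatures_def flip_curvature_eq)
qed

definition curv_ratio :: "(int \<Rightarrow> 'a::field) \<Rightarrow> int \<Rightarrow> 'a" where
  "curv_ratio \<mu> i = \<mu> i / \<mu> (i - 1)"

lemma curv_ratio_curvatures:
  assumes "\<mu> \<in> curvatures n"
  shows "curv_ratio \<mu> i \<noteq> 0" "curv_ratio \<mu> (i + int n) = curv_ratio \<mu> i"
proof -
  have \<mu>: "\<mu> i \<noteq> 0" "\<mu> (i + int n) = \<mu> i" for i using assms by (auto simp: curvatures_def)
  show "curv_ratio \<mu> i \<noteq> 0" using \<mu>(1) by (simp add: curv_ratio_def)
  show "curv_ratio \<mu> (i + int n) = curv_ratio \<mu> i"
    using \<mu>(2)[of i] \<mu>(2)[of "i - 1"] by (simp add: curv_ratio_def algebra_simps)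
qed

lemma flip_polygon_eq:
  "flip_polygon n j \<mu> (p, M) = (flip_seq (residue_class n j) (curv_ratio \<mu>) p, M)"
  by (simp add: flip_polygon_def flip_seq_def residue_class_def curv_ratio_def fun_eq_iff)

text \<open>Cross-ratios characterise the flipped vertices, so projective invariance carries over.  Applied
to the monodromy, this also shows that flipped polygons are twisted polygons.\<close>

lemma flip_seq_pgl:
  assumes "regular p" "\<And>i. q i \<noteq> 0"
  shows "flip_seq S q (\<lambda>i. pgl_apply A (p i)) = (\<lambda>i. pgl_apply A (flip_seq S q p i))"
proof
  fix i
  have "p i \<noteq> p (i + 1)" "p i \<noteq> p (i - 1)" "p (i + 1) \<noteq> p (i - 1)"
    using regularD[OF assms(1), of i] by auto
  then show "flip_seq S q (\<lambda>i. pgl_apply A (p i)) i = pgl_apply A (flip_seq S q p i)"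
    using assms(2) by (simp add: flip_seq_def h_map_pgl_apply)
qed

lemma flip_polygon_pgl_act:
  assumes "P \<in> ngons n" "\<mu> \<in> curvatures n"
  shows "flip_polygon n j \<mu> (pgl_act A P) = pgl_act A (flip_polygon n j \<mu> P)"
  using assms flip_seq_pgl[where q = "curv_ratio \<mu>"] curv_ratio_curvatures(1)[OF assms(2)]
  by (cases P) (simp add: pgl_act_def flip_polygon_eq ngons_iff)

definition flippable :: "int set \<Rightarrow> (int \<Rightarrow> 'a::field) \<Rightarrow> (int \<Rightarrow> 'a) \<Rightarrow> bool" where
  "flippable S q c \<longleftrightarrow> (\<forall>i\<in>S. right_factor q c i \<noteq> 0 \<and> left_factor q c i \<noteq> 0)"

lemma flip_polygon_coords:
  assumes n: "n \<ge> 3" and P: "P \<in> ngons n" and \<mu>: "\<mu> \<in> curvatures n"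
  shows "flip_polygon n j \<mu> P \<in> ngons n \<longleftrightarrow>
      flippable (residue_class n j) (curv_ratio \<mu>) (polygon_cr P)"
    and "polygon_cr (flip_polygon n j \<mu> P)
      = flip_cr (residue_class n j) (curv_ratio \<mu>) (polygon_cr P)"
proof -
  let ?S = "residue_class n j" and ?q = "curv_ratio \<mu>"
  obtain p M where pM: "P = (p, M)" by (cases P)
  have p: "regular p" "p (i + int n) = pgl_apply M (p i)" for i
    using P by (auto simp: pM ngons_iff)
  have q: "?q i \<noteq> 0" "?q (i + int n) = ?q i" for i using curv_ratio_curvatures[OF \<mu>] by auto
  have S: "sparse ?S" by (rule sparse_residue_class[OF n])
  have "flip_seq ?S ?q p (i + int n) = flip_seq ?S ?q (\<lambda>i. p (i + int n)) i" for i
    using residue_class_periodic[of i n j] q(2)[of i] by (simp add: flip_seq_def algebra_simps)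
  then have "flip_seq ?S ?q p (i + int n) = pgl_apply M (flip_seq ?S ?q p i)" for i
    using flip_seq_pgl[where q = ?q, OF p(1) q(1)] by (simp add: p(2))
  then show "flip_polygon n j \<mu> P \<in> ngons n \<longleftrightarrow> flippable ?S ?q (polygon_cr P)"
    using flip_seq_regular_iff[where q = ?q, OF p(1) q(1) S]
    by (simp add: pM flip_polygon_eq ngons_iff flippable_def)
  show "polygon_cr (flip_polygon n j \<mu> P) = flip_cr ?S ?q (polygon_cr P)"
    unfolding pM flip_polygon_eq by (rule polygon_cr_flip_seq[where q = ?q, OF p(1) q(1) S])
qed

definition flip_coords :: "nat \<Rightarrow> int \<Rightarrow> (int \<Rightarrow> 'a::field) \<times> (int \<Rightarrow> 'a)
    \<Rightarrow> ((int \<Rightarrow> 'a) \<times> (int \<Rightarrow> 'a)) option" where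
  "flip_coords n j = (\<lambda>(c, \<mu>).
     if flippable (residue_class n j) (curv_ratio \<mu>) c
     then Some (flip_cr (residue_class n j) (curv_ratio \<mu>) c, flip_curvature n j \<mu>) else None)"

lemma flip_coords_in_torus:
  assumes "n \<ge> 3" "z \<in> torus n" "flip_coords n j z = Some z'"
  shows "z' \<in> torus n"
proof -
  obtain c \<mu> where z: "z = (c, \<mu>)" by (cases z)
  with assms have \<mu>: "\<mu> \<in> curvatures n" and c: "c \<in> curvatures n" by (auto simp: torus_def)
  obtain P where P: "P \<in> ngons n" "polygon_cr P = c" using ngon_with_cross_ratios[OF c] .
  have "flippable (residue_class n j) (curv_ratio \<mu>) c"
    and z': "z' = (flip_cr (residue_class n j) (curv_ratio \<mu>) c, flip_curvature n j \<mu>)"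
    using assms(3) by (auto simp: z flip_coords_def split: if_splits)
  then have "flip_polygon n j \<mu> P \<in> ngons n"
    using flip_polygon_coords(1)[OF assms(1) P(1) \<mu>] P(2) by simp
  then have "flip_cr (residue_class n j) (curv_ratio \<mu>) c \<in> curvatures n"
    using polygon_cr_in_curvatures flip_polygon_coords(2)[OF assms(1) P(1) \<mu>] P(2) by metis
  then show ?thesis
    using flip_curvature_in_curvatures[OF \<mu>] by (simp add: z' torus_def)
qed

text \<open>The image of an orbit is contained in the fibre of the flipped coordinates.  Equivariance shows
that it is the whole fibre, as the latter is an orbit as well.\<close>

lemma flip_point:
  assumes n: "n \<ge> 3" and z: "z \<in> torus n"
  shows "flip n j (point n z) = map_option (point n) (flip_coords n j z)"
proof -
  obtain c \<mu> where c\<mu>: "z = (c, \<mu>)" by (cases z)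
  with z have \<mu>: "\<mu> \<in> curvatures n" and c: "c \<in> curvatures n" by (auto simp: torus_def)
  let ?S = "residue_class n j" and ?q = "curv_ratio \<mu>" and ?f = "flip_polygon n j \<mu>"
  obtain P where P: "P \<in> ngons n" "polygon_cr P = c" using ngon_with_cross_ratios[OF c] .
  have f: "?f Q \<in> ngons n \<longleftrightarrow> flippable ?S ?q c" "polygon_cr (?f Q) = flip_cr ?S ?q c"
    if "Q \<in> fibre n c" for Q
    using flip_polygon_coords[OF n _ \<mu>, of Q j] that by (auto simp: fibre_def)
  have P': "P \<in> fibre n c" using P by (simp add: fibre_def)
  show ?thesis
  proof (cases "flippable ?S ?q c")
    case True
    have "?f ` fibre n c = fibre n (flip_cr ?S ?q c)"
    proof (intro equalityI subsetI)
      fix Q assume "Q \<in> fibre n (flip_cr ?S ?q c)"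
      then have "Q \<in> ngons n" "polygon_cr Q = polygon_cr (?f P)"
        using f(2)[OF P'] by (auto simp: fibre_def)
      then obtain A where "Q = pgl_act A (?f P)"
        using pgl_related_iff f(1)[OF P'] True by blast
      then have "Q = ?f (pgl_act A P)" using flip_polygon_pgl_act[OF P(1) \<mu>] by metis
      moreover have "pgl_act A P \<in> fibre n c" using pgl_act_ngons[OF P(1)] P(2) by (simp add: fibre_def)
      ultimately show "Q \<in> ?f ` fibre n c" by blast
    qed (use f True in \<open>auto simp: fibre_def\<close>)
    moreover have "flip_cr ?S ?q c \<in> curvatures n"
      using polygon_cr_in_curvatures f[OF P'] True by metis
    ultimately show ?thesis
      using True by (simp add: c\<mu> flip_def point_def flip_coords_def polygon_moduli_eq)
  next
    case False
    have "?f ` fibre n c \<notin> polygon_moduli n"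
    proof
      assume "?f ` fibre n c \<in> polygon_moduli n"
      then have "?f P \<in> ngons n" using P' by (auto simp: polygon_moduli_eq fibre_def)
      with f(1)[OF P'] False show False by simp
    qed
    with False show ?thesis by (simp add: c\<mu> flip_def point_def flip_coords_def)
  qed
qed

section \<open>The scaling action in coordinates\<close>

definition scale_den :: "'a::field \<Rightarrow> 'a \<Rightarrow> 'a \<Rightarrow> 'a" where
  "scale_den \<eta> t m = 1 + (t - 1) * \<eta> * m"

definition scale_coords :: "'a::field \<Rightarrow> 'a \<Rightarrow> (int \<Rightarrow> 'a) \<times> (int \<Rightarrow> 'a)
    \<Rightarrow> ((int \<Rightarrow> 'a) \<times> (int \<Rightarrow> 'a)) option" where
  "scale_coords \<eta> t = (\<lambda>(c, \<mu>). if \<forall>i. scale_den \<eta> t (\<mu> i) \<noteq> 0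
     then Some (\<lambda>i. c i * scale_den \<eta> t (\<mu> i), \<lambda>i. t * \<mu> i / scale_den \<eta> t (\<mu> i)) else None)"

lemma scale_coords_in_torus:
  "z \<in> torus n \<Longrightarrow> t \<noteq> 0 \<Longrightarrow> scale_coords \<eta> t z = Some z' \<Longrightarrow> z' \<in> torus n"
  by (auto simp: scale_coords_def torus_def curvatures_def split: if_splits)

lemma scale_coords_1: "scale_coords \<eta> 1 z = Some z"
  by (cases z) (simp add: scale_coords_def scale_den_def)

text \<open>The denominators form a cocycle: the one for \<open>s\<close> at the image of \<open>m\<close> under the scaling by \<open>t\<close> is
the quotient of those for \<open>s * t\<close> and \<open>t\<close> at \<open>m\<close>.  This settles the formulas and the domains of
definition together.\<close>

lemma scale_coords_compose:
  assumes "scale_coords \<eta> t z = Some z'"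
  shows "scale_coords \<eta> s z' = scale_coords \<eta> (s * t) z"
proof -
  obtain c \<mu> where z: "z = (c, \<mu>)" by (cases z)
  have D: "scale_den \<eta> t (\<mu> i) \<noteq> 0" for i
    using assms by (auto simp: z scale_coords_def split: if_splits)
  have z': "z' = (\<lambda>i. c i * scale_den \<eta> t (\<mu> i), \<lambda>i. t * \<mu> i / scale_den \<eta> t (\<mu> i))"
    using assms by (auto simp: z scale_coords_def split: if_splits)
  have *: "scale_den \<eta> s (t * m / scale_den \<eta> t m) = scale_den \<eta> (s * t) m / scale_den \<eta> t m"
    if "scale_den \<eta> t m \<noteq> 0" for m
  proof -
    have "scale_den \<eta> s (t * m / d) = (d + (s - 1) * \<eta> * t * m) / d" if "d \<noteq> 0" for d
      using that by (simp add: scale_den_def field_simps)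
    moreover have "scale_den \<eta> t m + (s - 1) * \<eta> * t * m = scale_den \<eta> (s * t) m"
      by (simp add: scale_den_def algebra_simps)
    ultimately show ?thesis using that by simp
  qed
  show ?thesis
    using D by (simp add: z z' scale_coords_def *[OF D] fun_eq_iff)
qed

lemma on_set_mult: "on_set S (\<lambda>i. f i * g i) i = on_set S f i * on_set S g (i :: int)"
  for f g :: "int \<Rightarrow> 'a::field"
  by (simp add: on_set_def)

text \<open>The scaled quantities are marked with a prime.  All of them are related to the original ones by
the ratio \<open>r\<close> of consecutive denominators, through the identity \<open>diff\<close>.  Both composites
are defined under the same conditions: a flip only permutes the denominators \<open>D\<close>, and the scaling
multiplies the factors that must not vanish for the flip by \<open>1\<close> or by \<open>r\<close>.\<close>

lemma flip_scale_commute: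
  assumes n: "n \<ge> 3" and z: "z \<in> torus n" and t: "t \<noteq> 0"
  shows "Option.bind (scale_coords \<eta> t z) (flip_coords n j)
    = Option.bind (flip_coords n j z) (scale_coords \<eta> t)"
proof -
  obtain c \<mu> where c\<mu>: "z = (c, \<mu>)" by (cases z)
  then have \<mu>: "\<mu> i \<noteq> 0" for i using z by (simp add: torus_def curvatures_def)
  let ?S = "residue_class n j"
  define q where "q = curv_ratio \<mu>"
  define D where "D i = scale_den \<eta> t (\<mu> i)" for i
  have S: "sparse ?S" by (rule sparse_residue_class[OF n])
  have den: "(\<forall>i. scale_den \<eta> t (flip_curvature n j \<mu> i) \<noteq> 0) \<longleftrightarrow> (\<forall>i. D i \<noteq> 0)"
    using flip_index_involution[OF S] unfolding flip_curvature_eq D_def by metis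
  show ?thesis
  proof (cases "\<forall>i. D i \<noteq> 0")
    case False
    with den show ?thesis
      by (auto simp: c\<mu> scale_coords_def flip_coords_def simp flip: D_def)
  next
    case True
    define r where "r i = D (i - 1) / D i" for i
    define q' where "q' = curv_ratio (\<lambda>i. t * \<mu> i / D i)"
    define c' where "c' i = c i * D i" for i
    have r: "r i \<noteq> 0" for i using True by (simp add: r_def)
    have q': "q' = (\<lambda>i. q i * r i)"
      using True t by (simp add: q'_def q_def curv_ratio_def r_def fun_eq_iff)
    \<comment> \<open>The terms with \<open>\<eta>\<close> cancel because \<open>q i * \<mu> (i - 1) = \<mu> i\<close>.\<close>
    have diff: "q i * D (i - 1) - D i = q i - 1" for i
      using \<mu> by (simp add: q_def curv_ratio_def D_def scale_den_def field_simps)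
    have "right_factor q' c' i = right_factor q c i" for i
    proof -
      have "right_factor q' c' i = 1 + (q i * D (i - 1) - D i) * c i"
        using True by (simp add: right_factor_def q' c'_def r_def field_simps)
      then show ?thesis by (simp add: diff right_factor_def)
    qed
    then have right: "right_factor q' c' = right_factor q c" by (rule ext)
    have "left_factor q' c' i = left_factor q c i * r i" for i
    proof -
      have "left_factor q' c' i = (q i - (q i * D (i - 1) - D i) * c (i - 1)) * r i"
        using True by (simp add: left_factor_def q' c'_def r_def field_simps)
      then show ?thesis by (simp add: diff left_factor_def algebra_simps)
    qed
    then have left: "left_factor q' c' = (\<lambda>i. left_factor q c i * r i)" by (rule ext)
    have flippable: "flippable ?S q' c' \<longleftrightarrow> flippable ?S q c"
      using r by (simp add: flippable_def left right)
    have "flip_cr ?S q' c' i = flip_cr ?S q c i * D (flip_index ?S i)" for i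
    proof -
      have "i + 1 \<notin> ?S" if "i \<in> ?S" using S that by (auto simp: sparse_def)
      \<comment> \<open>A flip at i replaces D i by D (i - 1), and one at i + 1 replaces D i by D (i + 1).\<close>
      then have idx: "D i * on_set ?S r i / on_set ?S r (i + 1) = D (flip_index ?S i)"
        using True by (simp add: on_set_def flip_index_def r_def)
      have "on_set ?S r (i + 2) \<noteq> 0" using r by (simp add: on_set_def)
      then have "flip_cr ?S q' c' i
          = flip_cr ?S q c i * (D i * on_set ?S r i / on_set ?S r (i + 1))"
        unfolding flip_cr_def right left unfolding q' on_set_mult c'_def
        by (simp add: mult_ac)
      then show ?thesis unfolding idx .
    qed
    then show ?thesis
      using True den flippable
      by (simp add: c\<mu> scale_coords_def flip_coords_def flip_curvature_eq D_def[symmetric]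
          q_def[symmetric] q'_def[symmetric] c'_def[symmetric] fun_eq_iff)
  qed
qed

section \<open>The rational map\<close>

text \<open>The only constants are \<open>1\<close>, \<open>-1\<close> and \<open>\<eta>\<close>, so the map can be evaluated over every field to which the
constants are transported with \<open>1\<close> and \<open>-1\<close> preserved.\<close>

definition scaling_map :: "'f::field \<Rightarrow> 'f rational_map" where
  "scaling_map \<eta> = (let d = \<lambda>i. Add (Const 1)
       (Mult (Mult (Add (Var Param) (Const (- 1))) (Const \<eta>)) (Var (Curv i))) in
     \<lparr>num = case_coord (Var Param) (\<lambda>i. Mult (Var (Cross i)) (d i))
        (\<lambda>i. Mult (Var Param) (Var (Curv i))),
      den = case_coord (Const 1) (\<lambda>i. Const 1) d\<rparr>)"

lemma curvatures_mod:
  assumes "f \<in> curvatures n" shows "f (i mod int n) = f i"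
proof -
  have f: "f (i + int n) = f i" for i using assms by (simp add: curvatures_def)
  have "f (x + k * int n) = f x" for k x
  proof (induction k rule: int_induct[where k = 0])
    case (step1 k)
    then show ?case using f[of "x + k * int n"] by (simp add: algebra_simps)
  next
    case (step2 k)
    then show ?case using f[of "x + (k - 1) * int n"] by (simp add: algebra_simps)
  qed simp
  from this[of "i mod int n" "i div int n"] show ?thesis by simp
qed

text \<open>The rational map constrains coordinates with indices between \<open>0\<close> and \<open>n\<close> only; by periodicity this
amounts to a constraint on all indices.\<close>

lemma maps_to_scaling_map:
  fixes \<iota> :: "'f::field \<Rightarrow> 'k::field"
  assumes "\<iota> 1 = 1" "\<iota> (- 1) = - 1" "n > 0" "t \<noteq> 0" "z \<in> torus n" "z' \<in> torus n"
  shows "maps_to \<iota> n (scaling_map \<eta>) t (point n z) (point n z')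
    \<longleftrightarrow> scale_coords (\<iota> \<eta>) t z = Some z'"
proof -
  obtain c \<mu> where z: "z = (c, \<mu>)" by (cases z)
  obtain c' \<mu>' where z': "z' = (c', \<mu>')" by (cases z')
  have tor: "c \<in> curvatures n" "\<mu> \<in> curvatures n" "c' \<in> curvatures n" "\<mu>' \<in> curvatures n"
    using assms by (auto simp: torus_def z z')
  have all: "(\<forall>i\<in>{0..<int n}. Q (c i) (\<mu> i) (c' i) (\<mu>' i)) \<longleftrightarrow> (\<forall>i. Q (c i) (\<mu> i) (c' i) (\<mu>' i))"
    for Q
  proof
    assume *: "\<forall>i\<in>{0..<int n}. Q (c i) (\<mu> i) (c' i) (\<mu>' i)"
    show "\<forall>i. Q (c i) (\<mu> i) (c' i) (\<mu>' i)"
    proof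
      fix i
      have "i mod int n \<in> {0..<int n}" using \<open>n > 0\<close> by simp
      from *[rule_format, OF this] show "Q (c i) (\<mu> i) (c' i) (\<mu>' i)"
        by (simp only: curvatures_mod[OF tor(1)] curvatures_mod[OF tor(2)]
            curvatures_mod[OF tor(3)] curvatures_mod[OF tor(4)])
    qed
  qed blast
  have "maps_to \<iota> n (scaling_map \<eta>) t (point n z) (point n z') \<longleftrightarrow>
    (\<forall>i\<in>{0..<int n}. scale_den (\<iota> \<eta>) t (\<mu> i) \<noteq> 0 \<and> c' i = c i * scale_den (\<iota> \<eta>) t (\<mu> i) \<and>
      \<mu>' i = t * \<mu> i / scale_den (\<iota> \<eta>) t (\<mu> i))"
  proof -
    have E: "point n z \<in> enriched_moduli n" "point n z' \<in> enriched_moduli n"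
      using assms by (auto simp: enriched_moduli_eq)
    have v: "class_cr (fst (point n z)) = c" "snd (point n z) = \<mu>"
      "class_cr (fst (point n z')) = c'" "snd (point n z') = \<mu>'"
      using tor by (simp_all add: z z' point_def class_cr_fibre)
    have "maps_to \<iota> n (scaling_map \<eta>) t (point n z) (point n z') \<longleftrightarrow>
      (\<forall>i\<in>{0..<int n}. c' i = c i * scale_den (\<iota> \<eta>) t (\<mu> i)) \<and>
      (\<forall>i\<in>{0..<int n}. scale_den (\<iota> \<eta>) t (\<mu> i) \<noteq> 0 \<and>
        \<mu>' i = t * \<mu> i / scale_den (\<iota> \<eta>) t (\<mu> i))"
      using assms(1,2,4) E
      by (simp add: maps_to_def ball_Un scaling_map_def Let_def v scale_den_def)
    then show ?thesis by blast
  qed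
  also have "\<dots> \<longleftrightarrow> (\<forall>i. scale_den (\<iota> \<eta>) t (\<mu> i) \<noteq> 0 \<and> c' i = c i * scale_den (\<iota> \<eta>) t (\<mu> i) \<and>
      \<mu>' i = t * \<mu> i / scale_den (\<iota> \<eta>) t (\<mu> i))"
    by (rule all)
  also have "\<dots> \<longleftrightarrow> scale_coords (\<iota> \<eta>) t z = Some z'"
    by (auto simp: scale_coords_def z z' fun_eq_iff)
  finally show ?thesis .
qed

lemma apply_scaling_map:
  fixes \<iota> :: "'f::field \<Rightarrow> 'k::field"
  assumes "\<iota> 1 = 1" "\<iota> (- 1) = - 1" "n > 0" "t \<noteq> 0" "z \<in> torus n"
  shows "apply_map \<iota> n (scaling_map \<eta>) t (point n z)
    = map_option (point n) (scale_coords (\<iota> \<eta>) t z)"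
proof -
  have "maps_to \<iota> n (scaling_map \<eta>) t (point n z) y \<longleftrightarrow>
    (\<exists>z'. scale_coords (\<iota> \<eta>) t z = Some z' \<and> y = point n z')" for y
  proof
    assume *: "maps_to \<iota> n (scaling_map \<eta>) t (point n z) y"
    then have "y \<in> point n ` torus n" by (simp add: maps_to_def flip: enriched_moduli_eq)
    with * show "\<exists>z'. scale_coords (\<iota> \<eta>) t z = Some z' \<and> y = point n z'"
      using maps_to_scaling_map[OF assms] by blast
  next
    assume "\<exists>z'. scale_coords (\<iota> \<eta>) t z = Some z' \<and> y = point n z'"
    then show "maps_to \<iota> n (scaling_map \<eta>) t (point n z) y"
      using maps_to_scaling_map[OF assms] scale_coords_in_torus[OF assms(5,4)] by blast
  qed
  then have *: "maps_to \<iota> n (scaling_map \<eta>) t (point n z)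
    = (\<lambda>y. \<exists>z'. scale_coords (\<iota> \<eta>) t z = Some z' \<and> y = point n z')" by (rule ext)
  show ?thesis
    unfolding apply_map_def * by (cases "scale_coords (\<iota> \<eta>) t z") (simp_all add: Ex1_def)
qed

lemma scaling_map_action:
  fixes \<iota> :: "'f::field \<Rightarrow> 'k::field"
  assumes \<iota>: "\<iota> 1 = 1" "\<iota> (- 1) = - 1" and n: "n \<ge> 3" and \<eta>: "\<iota> \<eta> \<noteq> 0"
  shows "partial_action n (apply_map \<iota> n (scaling_map \<eta>))"
    and "commutes_with_flips n (apply_map \<iota> n (scaling_map \<eta>))"
    and "acts_by_scaling n (\<iota> \<eta>) (apply_map \<iota> n (scaling_map \<eta>))"
proof -
  let ?\<rho> = "apply_map \<iota> n (scaling_map \<eta>)"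
  have \<rho>: "?\<rho> t (point n z) = map_option (point n) (scale_coords (\<iota> \<eta>) t z)"
    if "t \<noteq> 0" "z \<in> torus n" for t z
    using apply_scaling_map[OF \<iota>, of n t z] that n by simp
  show "partial_action n ?\<rho>"
    unfolding partial_action_def enriched_moduli_eq
  proof (intro conjI ballI allI impI)
    fix x :: "'k enriched" assume "x \<in> point n ` torus n"
    then show "?\<rho> 1 x = Some x" by (auto simp: \<rho> scale_coords_1)
  next
    fix x y :: "'k enriched" and s t :: 'k
    assume "x \<in> point n ` torus n" and st: "s \<noteq> 0" "t \<noteq> 0" and y: "?\<rho> t x = Some y"
    then obtain z where z: "z \<in> torus n" "x = point n z" by blast
    with y st obtain z' where z': "scale_coords (\<iota> \<eta>) t z = Some z'" "y = point n z'"
      by (auto simp: \<rho>)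
    then have "z' \<in> torus n" using scale_coords_in_torus z st by blast
    then show "?\<rho> s y = ?\<rho> (s * t) x"
      using z z' st scale_coords_compose[OF z'(1), of s] by (simp add: \<rho>)
  qed
  show "commutes_with_flips n ?\<rho>"
    unfolding commutes_with_flips_def enriched_moduli_eq
  proof (intro ballI allI impI)
    fix x :: "'k enriched" and t :: 'k and j
    assume "x \<in> point n ` torus n" and t: "t \<noteq> 0"
    then obtain z where z: "z \<in> torus n" "x = point n z" by blast
    have "Option.bind (?\<rho> t x) (flip n j)
        = map_option (point n) (Option.bind (scale_coords (\<iota> \<eta>) t z) (flip_coords n j))"
      using z t scale_coords_in_torus[OF z(1) t, of "\<iota> \<eta>"] flip_point[OF n]
      by (cases "scale_coords (\<iota> \<eta>) t z") (auto simp: \<rho>)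
    also have "\<dots> = map_option (point n) (Option.bind (flip_coords n j z) (scale_coords (\<iota> \<eta>) t))"
      by (simp only: flip_scale_commute[OF n z(1) t])
    also have "\<dots> = Option.bind (flip n j x) (?\<rho> t)"
      using z t flip_coords_in_torus[OF n z(1)] flip_point[OF n z(1)]
      by (cases "flip_coords n j z") (auto simp: \<rho>)
    finally show "Option.bind (?\<rho> t x) (flip n j) = Option.bind (flip n j x) (?\<rho> t)" .
  qed
  show "acts_by_scaling n (\<iota> \<eta>) ?\<rho>"
    unfolding acts_by_scaling_def enriched_moduli_eq
  proof (intro allI impI)
    fix t :: 'k and C and \<mu> :: "int \<Rightarrow> 'k"
    assume t: "t \<noteq> 0" and "(C, \<mu>) \<in> point n ` torus n"
    then obtain c where c: "(c, \<mu>) \<in> torus n" "C = fibre n c" by (auto simp: point_def)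
    then have x: "(C, \<mu>) = point n (c, \<mu>)" by (simp add: point_def)
    have \<mu>: "\<mu> i \<noteq> 0" for i using c(1) by (simp add: torus_def curvatures_def)
    have den: "scale_den (\<iota> \<eta>) t (\<mu> i) \<noteq> 0 \<longleftrightarrow> t \<noteq> 1 - inverse (\<iota> \<eta> * \<mu> i)" for i
    proof -
      have "scale_den (\<iota> \<eta>) t (\<mu> i) = (\<iota> \<eta> * \<mu> i) * (t - (1 - inverse (\<iota> \<eta> * \<mu> i)))"
        using \<mu> \<eta> by (simp add: scale_den_def field_simps)
      then show ?thesis using \<mu> \<eta> by simp
    qed
    have formula: "\<mu>' i = t * \<mu> i / (1 + (t - 1) * \<iota> \<eta> * \<mu> i) \<and>
        class_cr C' i = class_cr C i * (t * \<mu> i / \<mu>' i)"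
      if "?\<rho> t (C, \<mu>) = Some (C', \<mu>')" for C' \<mu>' i
    proof -
      from that obtain z' where z': "scale_coords (\<iota> \<eta>) t (c, \<mu>) = Some z'" "(C', \<mu>') = point n z'"
        unfolding x \<rho>[OF t c(1)] by auto
      then have "z' \<in> torus n" using scale_coords_in_torus c(1) t by blast
      with z' c show ?thesis
        using \<mu> t
        by (auto simp: scale_coords_def point_def torus_def class_cr_fibre scale_den_def split: if_splits)
    qed
    have "?\<rho> t (C, \<mu>) \<noteq> None \<longleftrightarrow> (\<forall>i. t \<noteq> 1 - inverse (\<iota> \<eta> * \<mu> i))"
      unfolding x \<rho>[OF t c(1)] by (simp add: scale_coords_def den)
    with formula show "(?\<rho> t (C, \<mu>) \<noteq> None \<longleftrightarrow> (\<forall>i. t \<noteq> 1 - inverse (\<iota> \<eta> * \<mu> i))) \<and>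
        (\<forall>C' \<mu>'. ?\<rho> t (C, \<mu>) = Some (C', \<mu>') \<longrightarrow>
           (\<forall>i. \<mu>' i = t * \<mu> i / (1 + (t - 1) * \<iota> \<eta> * \<mu> i) \<and>
                class_cr C' i = class_cr C i * (t * \<mu> i / \<mu>' i)))"
      by blast
  qed
qed

text \<open>For constant curvature \<open>m\<close> the scaling by \<open>s\<close> changes \<open>m\<close> unless \<open>s = 1\<close> or \<open>\<eta> m = 1\<close>.  With
\<open>\<eta> m = s\<close> both are excluded by \<open>s \<noteq> 1\<close>, and the denominator is \<open>s\<^sup>2 - s + 1\<close>.\<close>

lemma scaling_map_nontrivial:
  fixes \<iota> :: "'f::field \<Rightarrow> 'k::field" and s :: 'k
  assumes \<iota>: "\<iota> 1 = 1" "\<iota> (- 1) = - 1" and n: "n > 0" and \<eta>: "\<iota> \<eta> \<noteq> 0"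
    and s: "s \<noteq> 0" "s \<noteq> 1" "s * s - s + 1 \<noteq> 0"
  shows "nontrivial_action n (apply_map \<iota> n (scaling_map \<eta>))"
proof -
  define m where "m = s / \<iota> \<eta>"
  have m: "m \<noteq> 0" using s \<eta> by (simp add: m_def)
  define z where "z = ((\<lambda>i :: int. 1 :: 'k), (\<lambda>i :: int. m))"
  have z: "z \<in> torus n" using m by (simp add: z_def torus_def curvatures_def)
  have "scale_den (\<iota> \<eta>) s m = s * s - s + 1"
    using \<eta> by (simp add: scale_den_def m_def algebra_simps)
  with s(3) obtain z' where z': "scale_coords (\<iota> \<eta>) s z = Some z'"
    "snd z' = (\<lambda>i. s * m / (s * s - s + 1))"
    by (auto simp: scale_coords_def z_def)
  have "s * m / (s * s - s + 1) \<noteq> m"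
  proof
    assume "s * m / (s * s - s + 1) = m"
    then have "m * s = m * (s * s - s + 1)" using s(3) by (simp add: divide_eq_eq mult.commute)
    then have "s = s * s - s + 1" using m mult_left_cancel by blast
    then have "(s - 1) * (s - 1) = 0" by algebra
    with s(2) show False by simp
  qed
  then have "point n z' \<noteq> point n z"
    using z'(2) by (auto simp: point_def z_def fun_eq_iff map_prod_def split: prod.splits)
  moreover have "apply_map \<iota> n (scaling_map \<eta>) s (point n z) = Some (point n z')"
    using apply_scaling_map[OF \<iota> n s(1) z] z'(1) by simp
  moreover have "point n z \<in> enriched_moduli n" using z by (simp add: enriched_moduli_eq)
  ultimately show ?thesis unfolding nontrivial_action_def using s(1) by blast
qed

theorem proposition6p6:
  fixes n :: nat and \<eta> :: "'f::field"
  assumes "n \<ge> 3" and "\<eta> \<noteq> 0"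
  shows "\<exists>R :: 'f rational_map. scaling_symmetry n R \<and>
    acts_by_scaling n \<eta> (apply_map id n R) \<and>
    acts_by_scaling n (generic_ext \<eta>) (apply_map generic_ext n R)"
proof -
  have ext: "generic_ext 1 = (1 :: 'f poly fract)" "generic_ext (- 1) = (- 1 :: 'f poly fract)"
    unfolding generic_ext_def by (simp_all flip: to_fract_1 to_fract_uminus add: one_pCons)
  have ext_\<eta>: "generic_ext \<eta> \<noteq> 0" using assms(2) by (simp add: generic_ext_def)
  \<comment> \<open>The indeterminate is transcendental, so it satisfies the conditions for non-triviality over every base field.\<close>
  define s :: "'f poly fract" where "s = to_fract [:0, 1:]"
  have "s \<noteq> 0" "s \<noteq> 1"
    unfolding s_def by (simp_all flip: to_fract_1 add: one_pCons)
  moreover have "s * s - s + 1 = to_fract ([:0, 1:] * [:0, 1:] - [:0, 1:] + 1)"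
    by (simp only: s_def to_fract_mult to_fract_diff to_fract_add to_fract_1)
  then have "s * s - s + 1 \<noteq> 0" by (simp add: one_pCons)
  ultimately have "nontrivial_action n (apply_map generic_ext n (scaling_map \<eta>))"
    using scaling_map_nontrivial[of generic_ext n \<eta> s] ext ext_\<eta> assms(1) by simp
  then show ?thesis
    using scaling_map_action[of id n \<eta>] scaling_map_action[of generic_ext n \<eta>] assms ext ext_\<eta>
    unfolding scaling_symmetry_def by (intro exI[of _ "scaling_map \<eta>"]) simp
qed

end
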